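(* For every positive integer $k$, in the formal power series ring $\mathbb C[[\mathbf t]]$, \[ \sum_{n\ge0}\sum_{\underline\mu\vdash n}\frac{\mathrm{roots}_k^{B_n}(\underline\mu)}{|Z_{\underline\mu}|}\,\mathbf t^{\mathbf c(\underline\mu)}=\exp\Big(\sum_{j\ge1}\sum_{\theta\in\mathbb Z_2}\sum_{\substack{h\mid k\\ \gcd(h,j)=1}}\frac{t_{j,\theta}^{jk/h}}{2jk/h}\,\mathrm{roots}_h^{\mathbb Z_2}(\theta)\Big), \] where $h$ runs over positive divisors of $k$.
   Context: $B_n$ is the group of bijections $w$ of $\{\pm1,\dots,\pm n\}$ with $w(-i)=-w(i)$ ($B_0$ trivial). Cycles: if $c=(a_1,\dots,a_\ell)$ is a cycle of $w$ on $\{\pm1,\dots,\pm n\}$ so is $\bar c$ (negate entries); if $c\ne\bar c$, $c\bar c$ is a cycle of length $\ell$ and $\mathbb Z_2$-class $+1$; if $c=\bar c$, a cycle of length $\ell/2$ and class $-1$. Conjugacy classes of $B_n$ are indexed by bipartitions $\underline\mu=(\mu^+,\mu^-)\vdash n$, where $\mu^\theta$ lists the lengths of cycles of class $\theta$. $b_{j,\theta}$ denotes the number of parts of $\mu^\theta$ equal to $j$; $\mathbf t=(t_{j,\theta})_{j\ge1,\theta\in\{\pm1\}}$ are indeterminates and $\mathbf t^{\mathbf c(\underline\mu)}=\prod_{j,\theta}t_{j,\theta}^{jb_{j,\theta}}$. $\mathrm{roots}_k^{B_n}(\underline\mu)$ is the value of $\mathrm{roots}_k^{B_n}(g)=|\{h\in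 B_n:h^k=g\}|$ at any element of class $\underline\mu$, and $|Z_{\underline\mu}|$ is the order of the centralizer of such an element. $\mathbb Z_2=\{+1,-1\}$ and $\mathrm{roots}_h^{\mathbb Z_2}(\theta)=|\{\varepsilon\in\mathbb Z_2:\varepsilon^h=\theta\}|$. *)

theory Defs
  imports
    Complex_Main
    "HOL-Library.Multiset"
    "HOL-Combinatorics.Orbits"
    "HOL-Combinatorics.Permutations"
    "HOL-Algebra.Group"
begin

section \<open>Formal power series in arbitrarily many commuting indeterminates\<close>

text \<open>
  A monomial in indeterminates indexed by \<open>'v\<close> is a finite multiset over \<open>'v\<close> (the multiplicity
  of \<open>v\<close> is the exponent of \<open>v\<close>), and a power series is an arbitrary family of coefficients
  indexed by the monomials.
\<close>

typedef ('v, 'a) mfps = "UNIV :: ('v multiset \<Rightarrow> 'a) set"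
  morphisms mfps_nth Abs_mfps
  by simp

lemma mfps_nth_Abs [simp]: "mfps_nth (Abs_mfps f) = f"
  by (simp add: Abs_mfps_inverse)

lemma mfps_eq_iff: "F = G \<longleftrightarrow> (\<forall>M. mfps_nth F M = mfps_nth G M)"
  by (metis ext mfps_nth_inject)

lemma mfps_eqI: "(\<And>M. mfps_nth F M = mfps_nth G M) \<Longrightarrow> F = G"
  by (simp add: mfps_eq_iff)

lemma finite_submultisets: "finite {A. A \<subseteq># (M :: 'v multiset)}"
proof (induction M)
  case empty
  then show ?case by simp
next
  case (add x M)
  have "{A. A \<subseteq># add_mset x M} \<subseteq> {A. A \<subseteq># M} \<union> add_mset x ` {A. A \<subseteq># M}"
  proof
    fix A assume "A \<in> {A. A \<subseteq># add_mset x M}"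
    then have A: "A \<subseteq># add_mset x M" by simp
    show "A \<in> {A. A \<subseteq># M} \<union> add_mset x ` {A. A \<subseteq># M}"
    proof (cases "x \<in># A")
      case True
      then obtain B where B: "A = add_mset x B" by (meson mset_add)
      with A have "B \<subseteq># M" by simp
      with B show ?thesis by simp
    next
      case False
      with A have "A \<subseteq># M"
        by (metis add_mset_remove_trivial diff_single_trivial insert_DiffM2 subset_eq_diff_conv
            add_mset_add_single)
      then show ?thesis by simp
    qed
  qed
  then show ?case using add.IH finite_subset by blast
qed

instantiation mfps :: (type, comm_ring_1) comm_ring_1
begin

definition zero_mfps :: "('a, 'b) mfps"
  where "0 = Abs_mfps (\<lambda>M. 0)"

definition one_mfps :: "('a, 'b) mfps"
  where "1 = Abs_mfps (\<lambda>M. if M = {#} then 1 else 0)"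

definition plus_mfps :: "('a, 'b) mfps \<Rightarrow> ('a, 'b) mfps \<Rightarrow> ('a, 'b) mfps"
  where "F + G = Abs_mfps (\<lambda>M. mfps_nth F M + mfps_nth G M)"

definition uminus_mfps :: "('a, 'b) mfps \<Rightarrow> ('a, 'b) mfps"
  where "- F = Abs_mfps (\<lambda>M. - mfps_nth F M)"

definition minus_mfps :: "('a, 'b) mfps \<Rightarrow> ('a, 'b) mfps \<Rightarrow> ('a, 'b) mfps"
  where "F - G = Abs_mfps (\<lambda>M. mfps_nth F M - mfps_nth G M)"

definition times_mfps :: "('a, 'b) mfps \<Rightarrow> ('a, 'b) mfps \<Rightarrow> ('a, 'b) mfps"
  where "F * G = Abs_mfps (\<lambda>M. \<Sum>A | A \<subseteq># M. mfps_nth F A * mfps_nth G (M - A))"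

lemma mfps_nth_zero [simp]: "mfps_nth (0 :: ('a, 'b) mfps) M = 0"
  and mfps_nth_one: "mfps_nth (1 :: ('a, 'b) mfps) M = (if M = {#} then 1 else 0)"
  and mfps_nth_add [simp]: "mfps_nth (F + G :: ('a, 'b) mfps) M = mfps_nth F M + mfps_nth G M"
  and mfps_nth_uminus [simp]: "mfps_nth (- F :: ('a, 'b) mfps) M = - mfps_nth F M"
  and mfps_nth_diff [simp]: "mfps_nth (F - G :: ('a, 'b) mfps) M = mfps_nth F M - mfps_nth G M"
  and mfps_nth_mult: "mfps_nth (F * G :: ('a, 'b) mfps) M
        = (\<Sum>A | A \<subseteq># M. mfps_nth F A * mfps_nth G (M - A))"
  by (simp_all add: zero_mfps_def one_mfps_def plus_mfps_def uminus_mfps_def minus_mfps_def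
      times_mfps_def)

instance
proof
  fix F G H :: "('a, 'b) mfps"
  show "F * G * H = F * (G * H)"
  proof (rule mfps_eqI)
    fix M :: "'a multiset"
    have "mfps_nth (F * G * H) M
        = (\<Sum>A | A \<subseteq># M. \<Sum>B | B \<subseteq># A. mfps_nth F B * mfps_nth G (A - B) * mfps_nth H (M - A))"
      by (simp add: mfps_nth_mult sum_distrib_right)
    also have "\<dots> = (\<Sum>(A, B)\<in>(SIGMA A:{A. A \<subseteq># M}. {B. B \<subseteq># A}).
        mfps_nth F B * mfps_nth G (A - B) * mfps_nth H (M - A))"
      by (rule sum.Sigma) (auto simp: finite_submultisets)
    also have "\<dots> = (\<Sum>(B, C)\<in>(SIGMA B:{B. B \<subseteq># M}. {C. C \<subseteq># M - B}).
        mfps_nth F B * mfps_nth G C * mfps_nth H (M - B - C))"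
      by (rule sum.reindex_bij_witness[where i = "\<lambda>(B, C). (B + C, B)" and j = "\<lambda>(A, B). (B, A - B)"])
        (auto simp: subset_mset.le_diff_conv2 subset_mset.add_diff_inverse add.commute
          intro: subset_mset.order_trans)
    also have "\<dots> = (\<Sum>B | B \<subseteq># M. \<Sum>C | C \<subseteq># M - B.
        mfps_nth F B * mfps_nth G C * mfps_nth H (M - B - C))"
      by (rule sum.Sigma[symmetric]) (auto simp: finite_submultisets)
    also have "\<dots> = mfps_nth (F * (G * H)) M"
      by (simp add: mfps_nth_mult sum_distrib_left mult.assoc)
    finally show "mfps_nth (F * G * H) M = mfps_nth (F * (G * H)) M" .
  qed
  show "F * G = G * F"
  proof (rule mfps_eqI)
    fix M :: "'a multiset"
    show "mfps_nth (F * G) M = mfps_nth (G * F) M"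
      unfolding mfps_nth_mult
      by (rule sum.reindex_bij_witness[where i = "\<lambda>A. M - A" and j = "\<lambda>A. M - A"])
        (auto simp: mult.commute double_diff subset_mset.diff_diff_right)
  qed
  show "1 * F = F"
  proof (rule mfps_eqI)
    fix M :: "'a multiset"
    have "mfps_nth (1 * F) M
        = (\<Sum>A | A \<subseteq># M. if A = {#} then mfps_nth F M else 0)"
      unfolding mfps_nth_mult by (rule sum.cong) (auto simp: mfps_nth_one)
    also have "\<dots> = mfps_nth F M"
      by (simp add: sum.delta finite_submultisets)
    finally show "mfps_nth (1 * F) M = mfps_nth F M" .
  qed
  show "(F + G) * H = F * H + G * H"
    by (rule mfps_eqI) (simp add: mfps_nth_mult distrib_right sum.distrib)
  show "(0 :: ('a, 'b) mfps) \<noteq> 1"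
    by (auto simp: mfps_eq_iff mfps_nth_one intro!: exI[of _ "{#}"])
qed (auto intro!: mfps_eqI simp: add_ac)

end

definition mfps_const :: "'a :: comm_ring_1 \<Rightarrow> ('v, 'a) mfps"
  where "mfps_const c = Abs_mfps (\<lambda>M. if M = {#} then c else 0)"

definition mfps_var :: "'v \<Rightarrow> ('v, 'a :: comm_ring_1) mfps"
  where "mfps_var v = Abs_mfps (\<lambda>M. if M = {#v#} then 1 else 0)"

text \<open>
  Infinite sums are taken coefficientwise, for families in which every coefficient is nonzero for
  only finitely many members.
\<close>

definition mfps_summable :: "('i \<Rightarrow> ('v, 'a :: comm_ring_1) mfps) \<Rightarrow> 'i set \<Rightarrow> bool"
  where "mfps_summable F I \<longleftrightarrow> (\<forall>M. finite {i \<in> I. mfps_nth (F i) M \<noteq> 0})"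

definition mfps_sum :: "('i \<Rightarrow> ('v, 'a :: comm_ring_1) mfps) \<Rightarrow> 'i set \<Rightarrow> ('v, 'a) mfps"
  where "mfps_sum F I = Abs_mfps (\<lambda>M. \<Sum>i | i \<in> I \<and> mfps_nth (F i) M \<noteq> 0. mfps_nth (F i) M)"

text \<open>The exponential series, meaningful for series without constant term.\<close>

definition mfps_exp :: "('v, 'a :: field_char_0) mfps \<Rightarrow> ('v, 'a) mfps"
  where "mfps_exp F = mfps_sum (\<lambda>m. mfps_const (1 / fact m) * F ^ m) UNIV"

lemma mfps_nth_sum [simp]: "mfps_nth (\<Sum>i\<in>I. F i) M = (\<Sum>i\<in>I. mfps_nth (F i) M)"
  by (induction I rule: infinite_finite_induct) auto

lemma mfps_nth_const_mult [simp]: "mfps_nth (mfps_const c * F) M = c * mfps_nth F M"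
proof -
  have "mfps_nth (mfps_const c * F) M = (\<Sum>A | A \<subseteq># M. if A = {#} then c * mfps_nth F M else 0)"
    unfolding mfps_nth_mult by (rule sum.cong) (auto simp: mfps_const_def)
  then show ?thesis by (simp add: sum.delta finite_submultisets)
qed

lemma mfps_nth_power_eq_0:
  assumes "mfps_nth F {#} = 0" and "size M < m"
  shows "mfps_nth (F ^ m) M = 0"
  using assms(2)
proof (induction m arbitrary: M)
  case 0
  then show ?case by simp
next
  case (Suc m)
  have "mfps_nth F A * mfps_nth (F ^ m) (M - A) = 0" if "A \<subseteq># M" for A
  proof (cases "A = {#}")
    case True
    then show ?thesis using assms(1) by simp
  next
    case False
    then have "size (M - A) < m"
      using Suc.prems that size_mset_mono[OF that] nonempty_has_size[of A]
      by (simp add: size_Diff_submset)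
    then show ?thesis using Suc.IH by simp
  qed
  then show ?case by (simp add: mfps_nth_mult)
qed

lemma mfps_exp_summable:
  assumes "mfps_nth F {#} = 0"
  shows "mfps_summable (\<lambda>m. mfps_const (1 / fact m) * F ^ m) (UNIV :: nat set)"
  unfolding mfps_summable_def
proof
  fix M
  have "{m \<in> UNIV. mfps_nth (mfps_const (1 / fact m) * F ^ m) M \<noteq> 0} \<subseteq> {..size M}"
    using mfps_nth_power_eq_0[OF assms, of M] by (auto intro: leI)
  then show "finite {m \<in> UNIV. mfps_nth (mfps_const (1 / fact m) * F ^ m) M \<noteq> 0}"
    using finite_subset by blast
qed

lemma mfps_monom_mult:
  "Abs_mfps (\<lambda>M. if M = A then 1 else 0) * Abs_mfps (\<lambda>M. if M = B then 1 else 0)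
     = (Abs_mfps (\<lambda>M. if M = A + B then 1 else 0) :: ('v, 'a :: comm_ring_1) mfps)"
proof (rule mfps_eqI)
  fix M :: "'v multiset"
  have "mfps_nth (Abs_mfps (\<lambda>M. if M = A then 1 else 0) * Abs_mfps (\<lambda>M. if M = B then 1 else 0)
        :: ('v, 'a) mfps) M
      = (\<Sum>C | C \<subseteq># M. if C = A then (if M - A = B then 1 else 0) else 0)"
    unfolding mfps_nth_mult by (rule sum.cong) auto
  also have "\<dots> = (if A \<subseteq># M \<and> M - A = B then 1 else 0)"
    by (simp add: sum.delta finite_submultisets)
  also have "\<dots> = (if M = A + B then 1 else 0)"
    by (metis add_diff_cancel_left' mset_subset_eq_add_left subset_mset.add_diff_inverse)
  finally show "mfps_nth (Abs_mfps (\<lambda>M. if M = A then 1 else 0) * Abs_mfps (\<lambda>M. if M = B then 1 else 0)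
        :: ('v, 'a) mfps) M = mfps_nth (Abs_mfps (\<lambda>M. if M = A + B then 1 else 0)) M"
    by simp
qed

lemma mfps_var_power:
  "mfps_var v ^ e = (Abs_mfps (\<lambda>M. if M = replicate_mset e v then 1 else 0)
     :: ('v, 'a :: comm_ring_1) mfps)"
  by (induction e) (auto simp: one_mfps_def mfps_var_def mfps_monom_mult)

lemma mfps_prod_monom:
  "(\<Prod>i\<in>I. Abs_mfps (\<lambda>M. if M = f i then 1 else 0))
     = (Abs_mfps (\<lambda>M. if M = (\<Sum>i\<in>I. f i) then 1 else 0) :: ('v, 'a :: comm_ring_1) mfps)"
  by (induction I rule: infinite_finite_induct) (auto simp: one_mfps_def mfps_monom_mult)


section \<open>Hyperoctahedral groups\<close>

definition signed_points :: "nat \<Rightarrow> int set"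
  where "signed_points n = {i. i \<noteq> 0 \<and> \<bar>i\<bar> \<le> int n}"

text \<open>As usual for \<open>permutes\<close>, an element is extended by the identity outside \<open>{\<plusminus>1, \<dots>, \<plusminus>n}\<close>.\<close>

definition hyperoctahedral :: "nat \<Rightarrow> (int \<Rightarrow> int) monoid"
  where "hyperoctahedral n =
    \<lparr> carrier = {w. w permutes signed_points n \<and> (\<forall>i\<in>signed_points n. w (- i) = - w i)},
      mult = (\<circ>), one = id \<rparr>"

definition Z2 :: "int monoid"
  where "Z2 = \<lparr> carrier = {1, -1}, mult = (*), one = 1 \<rparr>"

definition roots :: "nat \<Rightarrow> ('g, 'm) monoid_scheme \<Rightarrow> 'g \<Rightarrow> nat"
  where "roots k G g = card {h \<in> carrier G. h [^]\<^bsub>G\<^esub> k = g}"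

definition centralizer :: "('g, 'm) monoid_scheme \<Rightarrow> 'g \<Rightarrow> 'g set"
  where "centralizer G g = {h \<in> carrier G. h \<otimes>\<^bsub>G\<^esub> g = g \<otimes>\<^bsub>G\<^esub> h}"

lemma group_hyperoctahedral: "group (hyperoctahedral n)"
proof (rule groupI)
  fix x assume x: "x \<in> carrier (hyperoctahedral n)"
  then have p: "x permutes signed_points n"
    and neg: "\<And>i. i \<in> signed_points n \<Longrightarrow> x (- i) = - x i"
    by (auto simp: hyperoctahedral_def)
  define y where "y = inv_into UNIV x"
  have y: "y permutes signed_points n" and xy: "\<And>i. x (y i) = i" and yx: "\<And>i. y (x i) = i"
    using permutes_inv[OF p] permutes_inverses[OF p] by (simp_all add: y_def)
  have "y (- i) = - y i" if i: "i \<in> signed_points n" for i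
  proof -
    have "y i \<in> signed_points n"
      using permutes_in_image[OF y] i by simp
    then have "x (- y i) = - i"
      using neg xy by simp
    then show ?thesis using yx by metis
  qed
  then have "y \<in> carrier (hyperoctahedral n)"
    using y by (auto simp: hyperoctahedral_def)
  then show "\<exists>y\<in>carrier (hyperoctahedral n). y \<otimes>\<^bsub>hyperoctahedral n\<^esub> x = \<one>\<^bsub>hyperoctahedral n\<^esub>"
    using yx by (intro bexI[of _ y]) (auto simp: hyperoctahedral_def)
qed (auto simp: hyperoctahedral_def permutes_compose permutes_id comp_assoc permutes_in_image)

lemma comm_group_Z2: "comm_group Z2"
  by (rule comm_groupI) (auto simp: Z2_def)


section \<open>Signed cycle type\<close>

text \<open>
  A cycle \<open>c\<close> is represented by its set of entries (an orbit of \<open>w\<close>); since negation commutes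
  with \<open>w\<close>, the cycles \<open>c\<close> and \<open>-c\<close> are equal iff their sets of entries are. A cycle of the
  signed permutation \<open>w\<close>, i.e. the product of \<open>c\<close> and \<open>-c\<close> if these differ (class \<open>1\<close>), and \<open>c\<close>
  itself otherwise (class \<open>-1\<close>), is represented by the union of \<open>c\<close> and \<open>-c\<close>. In both
  cases its length is half the cardinality of this union.
\<close>

definition signed_cycles :: "nat \<Rightarrow> (int \<Rightarrow> int) \<Rightarrow> int \<Rightarrow> int set set"
  where "signed_cycles n w \<theta> =
    {c \<union> uminus ` c | c. c \<in> orbit w ` signed_points n \<and> \<theta> = (if c = uminus ` c then -1 else 1)}"

definition cycle_lengths :: "nat \<Rightarrow> (int \<Rightarrow> int) \<Rightarrow> int \<Rightarrow> nat multiset"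
  where "cycle_lengths n w \<theta> = image_mset (\<lambda>C. card C div 2) (mset_set (signed_cycles n w \<theta>))"

text \<open>A bipartition is a pair \<open>(\<mu>\<^sup>+, \<mu>\<^sup>-)\<close>, each component being the multiset of its parts.\<close>

type_synonym bipartition = "nat multiset \<times> nat multiset"

definition part :: "bipartition \<Rightarrow> int \<Rightarrow> nat multiset"
  where "part \<mu> \<theta> = (if \<theta> = 1 then fst \<mu> else snd \<mu>)"

definition bipartitions :: "nat \<Rightarrow> bipartition set"
  where "bipartitions n = {\<mu>. 0 \<notin># fst \<mu> \<and> 0 \<notin># snd \<mu> \<and> sum_mset (fst \<mu>) + sum_mset (snd \<mu>) = n}"

definition cycle_type :: "nat \<Rightarrow> (int \<Rightarrow> int) \<Rightarrow> bipartition"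
  where "cycle_type n w = (cycle_lengths n w 1, cycle_lengths n w (-1))"

text \<open>The common value of a class function on the elements of cycle type \<open>\<mu>\<close>; it is determined
  because these elements form a (nonempty) conjugacy class whenever \<open>\<mu>\<close> is a bipartition of \<open>n\<close>.\<close>

definition class_value :: "nat \<Rightarrow> ((int \<Rightarrow> int) \<Rightarrow> nat) \<Rightarrow> bipartition \<Rightarrow> nat"
  where "class_value n f \<mu> =
    (THE c. \<forall>g\<in>carrier (hyperoctahedral n). cycle_type n g = \<mu> \<longrightarrow> f g = c)"

definition roots_B :: "nat \<Rightarrow> nat \<Rightarrow> bipartition \<Rightarrow> nat"
  where "roots_B k n = class_value n (roots k (hyperoctahedral n))"

definition centralizer_order_B :: "nat \<Rightarrow> bipartition \<Rightarrow> nat"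
  where "centralizer_order_B n = class_value n (\<lambda>g. card (centralizer (hyperoctahedral n) g))"

text \<open>
  The indeterminate \<open>t\<^bsub>j,\<theta>\<^esub>\<close> is \<open>mfps_var (j, \<theta>)\<close>. The index type also provides
  indeterminates for \<open>j = 0\<close> or \<open>\<theta> \<notin> {1, -1}\<close>; these are never used.
\<close>

type_synonym tseries = "(nat \<times> int, complex) mfps"

abbreviation tvar :: "nat \<Rightarrow> int \<Rightarrow> tseries"
  where "tvar j \<theta> \<equiv> mfps_var (j, \<theta>)"

text \<open>The factors with \<open>j\<close> not a part of \<open>\<mu>\<^sup>\<theta>\<close> have exponent \<open>0\<close> and are omitted.\<close>

definition cycle_monomial :: "bipartition \<Rightarrow> tseries"
  where "cycle_monomial \<mu> =
    (\<Prod>\<theta>\<in>carrier Z2. \<Prod>j\<in>set_mset (part \<mu> \<theta>). tvar j \<theta> ^ (j * count (part \<mu> \<theta>) j))"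


section \<open>The sums under consideration are well defined\<close>

lemma finite_bipartitions: "finite (bipartitions n)"
proof -
  let ?P = "{m :: nat multiset. set_mset m \<subseteq> {..n} \<and> size m \<le> n}"
  have *: "set_mset m \<subseteq> {..n} \<and> size m \<le> n" if "0 \<notin># m" "sum_mset m \<le> n" for m :: "nat multiset"
  proof -
    have "size m \<le> sum_mset m" using that(1) by (induction m) (auto simp: Suc_le_eq)
    moreover have "x \<le> sum_mset m" if "x \<in># m" for x using that by (auto dest: multi_member_split)
    ultimately show ?thesis using that(2) by fastforce
  qed
  have "?P \<subseteq> mset ` {xs. set xs \<subseteq> {..n} \<and> length xs \<le> n}"
  proof
    fix m :: "nat multiset" assume "m \<in> ?P"
    moreover obtain xs where "mset xs = m" using ex_mset by blast
    ultimately show "m \<in> mset ` {xs. set xs \<subseteq> {..n} \<and> length xs \<le> n}" by force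
  qed
  then have "finite ?P"
    using finite_lists_length_le[of "{..n}" n] finite_surj by blast
  moreover have "bipartitions n \<subseteq> ?P \<times> ?P"
  proof
    fix \<mu> assume "\<mu> \<in> bipartitions n"
    then show "\<mu> \<in> ?P \<times> ?P"
      using *[of "fst \<mu>"] *[of "snd \<mu>"] by (cases \<mu>) (auto simp: bipartitions_def)
  qed
  ultimately show ?thesis using finite_subset by blast
qed

lemma size_sum_multiset: "size (\<Sum>i\<in>I. f i) = (\<Sum>i\<in>I. size (f i))"
  for f :: "'i \<Rightarrow> 'b multiset"
  by (induction I rule: infinite_finite_induct) auto

lemma sum_mset_eq_sum_count: "sum_mset m = (\<Sum>j\<in>set_mset m. j * count m j)"
  for m :: "nat multiset"
proof -
  have "sum_mset m = (\<Sum>j\<in>S. j * count m j)" if "finite S" "set_mset m \<subseteq> S" for S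
    using that(2)
  proof (induction m)
    case empty
    then show ?case by simp
  next
    case (add x m)
    have "(\<Sum>j\<in>S. j * count (add_mset x m) j) = (\<Sum>j\<in>S. (if j = x then x else 0) + j * count m j)"
      by (rule sum.cong) auto
    with add that(1) show ?case by (simp add: sum.distrib)
  qed
  then show ?thesis by simp
qed

lemma cycle_monomial_nth:
  assumes "\<mu> \<in> bipartitions n" and "mfps_nth (cycle_monomial \<mu>) M \<noteq> 0"
  shows "size M = n"
proof -
  let ?m = "\<Sum>\<theta>\<in>carrier Z2. \<Sum>j\<in>set_mset (part \<mu> \<theta>). replicate_mset (j * count (part \<mu> \<theta>) j) (j, \<theta>)"
  have "M = ?m"
    using assms(2) by (auto simp: cycle_monomial_def mfps_var_power mfps_prod_monom split: if_splits)
  also have "size ?m = (\<Sum>\<theta>\<in>carrier Z2. sum_mset (part \<mu> \<theta>))"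
    by (simp add: size_sum_multiset sum_mset_eq_sum_count)
  also have "\<dots> = n"
    using assms(1) by (simp add: Z2_def part_def bipartitions_def)
  finally show ?thesis .
qed

lemma roots_series_summable:
  "mfps_summable (\<lambda>n. \<Sum>\<mu>\<in>bipartitions n. mfps_const (f n \<mu>) * cycle_monomial \<mu>) UNIV"
  unfolding mfps_summable_def
proof
  fix M
  have "{n \<in> UNIV. mfps_nth (\<Sum>\<mu>\<in>bipartitions n. mfps_const (f n \<mu>) * cycle_monomial \<mu>) M \<noteq> 0}
      \<subseteq> {size M}"
  proof (intro subsetI, elim CollectE conjE)
    fix n assume "mfps_nth (\<Sum>\<mu>\<in>bipartitions n. mfps_const (f n \<mu>) * cycle_monomial \<mu>) M \<noteq> 0"
    then obtain \<mu> where "\<mu> \<in> bipartitions n" "mfps_nth (cycle_monomial \<mu>) M \<noteq> 0"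
      by (auto elim!: sum.not_neutral_contains_not_neutral)
    then show "n \<in> {size M}" using cycle_monomial_nth by simp
  qed
  then show "finite {n \<in> UNIV.
      mfps_nth (\<Sum>\<mu>\<in>bipartitions n. mfps_const (f n \<mu>) * cycle_monomial \<mu>) M \<noteq> 0}"
    using finite_subset by blast
qed

abbreviation (input) exponent_term :: "nat \<Rightarrow> nat \<Rightarrow> tseries"
  where "exponent_term k \<equiv> (\<lambda>j.
    \<Sum>\<theta>\<in>carrier Z2. \<Sum>h | h dvd k \<and> coprime h j.
       mfps_const (of_nat (roots h Z2 \<theta>) / of_nat (2 * j * (k div h))) * tvar j \<theta> ^ (j * (k div h)))"

lemma exponent_term_nth:
  assumes "k > 0" "j > 0" "mfps_nth (exponent_term k j) M \<noteq> 0"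
  shows "j \<in> fst ` set_mset M"
proof -
  obtain \<theta> h where h: "h dvd k" and "mfps_nth (tvar j \<theta> ^ (j * (k div h))) M \<noteq> 0"
    using assms(3) by (auto elim!: sum.not_neutral_contains_not_neutral)
  then have "M = replicate_mset (j * (k div h)) (j, \<theta>)"
    by (auto simp: mfps_var_power split: if_splits)
  moreover have "j * (k div h) > 0"
    using assms h by (auto elim!: dvdE)
  ultimately show ?thesis by (force simp: image_iff)
qed

lemma exponent_summable:
  assumes "k > 0"
  shows "mfps_summable (exponent_term k) {1..}"
  unfolding mfps_summable_def
proof
  fix M
  have "{j \<in> {1..}. mfps_nth (exponent_term k j) M \<noteq> 0} \<subseteq> fst ` set_mset M"
    using exponent_term_nth[OF assms] by auto
  then show "finite {j \<in> {1..}. mfps_nth (exponent_term k j) M \<noteq> 0}"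
    using finite_subset by blast
qed

lemma exponent_nth_empty:
  assumes "k > 0"
  shows "mfps_nth (mfps_sum (exponent_term k) {1..}) {#} = 0"
proof -
  have *: "mfps_nth (exponent_term k j) {#} = 0" if "j \<in> {1..}" for j
    using exponent_term_nth[OF assms, of j "{#}"] that by fastforce
  show ?thesis
    unfolding mfps_sum_def mfps_nth_Abs by (rule sum.neutral) (use * in blast)
qed

end

theory Submission
  imports
    Defs
    "HOL-Combinatorics.Cycles"
begin

text \<open>
  Send each point \<open>x\<close> of a signed permutation \<open>w\<close> to its type \<open>(j, \<theta>)\<close>: \<open>j\<close> is the least positive
  exponent with \<open>\<bar>w\<^sup>j x\<bar> = \<bar>x\<bar>\<close>, and \<open>w\<^sup>j x = \<theta> x\<close>. The monomial of \<open>w\<close> is then the multiset of the types of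
  its positive points, and taking \<open>k\<close>-th powers acts on types by
  \<open>(j, \<theta>) \<mapsto> (j / gcd j k, \<theta>\<^bsup>k / gcd j k\<^esup>)\<close>.

  Choosing the image of one point fixes an isomorphism on the orbit of that point, so the number \<open>z(M)\<close> of
  isomorphisms between two signed permutations with the same multiset \<open>M\<close> of types satisfies
  \<open>z(M) = 2 c z(M')\<close>, where \<open>c\<close> is the multiplicity of the type \<open>v\<close> in \<open>M\<close> and \<open>M'\<close> arises by deleting
  one cycle of type \<open>v\<close>. In particular \<open>z(M)\<close> is positive (so the type determines the conjugacy class)
  and equals the order of the centralizer. By the class equation, the coefficient at \<open>N\<close> of the left-hand
  side is the sum of \<open>1 / z(M)\<close> over all \<open>M\<close> that the \<open>k\<close>-th power sends to \<open>N\<close>. Multiplying by the degree and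
  using the recursion for \<open>z\<close> gives the differential equation \<open>D E = (D F) E\<close> that characterises
  \<open>E = exp F\<close>, with \<open>D\<close> the degree derivation.
\<close>

section \<open>Points and orbits of signed permutations\<close>

text \<open>Oddness is asked for at every integer, so that no rank \<open>n\<close> occurs and the
  lemmas serve all hyperoctahedral groups at once; \<open>permutation\<close> supplies finite
  support.\<close>

definition signed_perm :: "(int \<Rightarrow> int) \<Rightarrow> bool"
  where "signed_perm w \<longleftrightarrow> permutation w \<and> (\<forall>i. w (- i) = - w i)"

text \<open>This is the length of the cycle through \<bar>x\<bar> after forgetting signs, hence the
  length of the signed cycle in both classes: a cycle with c = -c has twice as many entries.\<close>

definition cyc_len :: "(int \<Rightarrow> int) \<Rightarrow> int \<Rightarrow> nat"
  where "cyc_len w x = (LEAST j. 0 < j \<and> \<bar>(w ^^ j) x\<bar> = \<bar>x\<bar>)"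

definition cyc_sign :: "(int \<Rightarrow> int) \<Rightarrow> int \<Rightarrow> int"
  where "cyc_sign w x = (if (w ^^ cyc_len w x) x = x then 1 else -1)"

definition point_type :: "(int \<Rightarrow> int) \<Rightarrow> int \<Rightarrow> nat \<times> int"
  where "point_type w x = (cyc_len w x, cyc_sign w x)"

text \<open>The union of the cycle through \<open>x\<close> and its negative. Comparing absolute
  values treats both classes uniformly.\<close>

definition signed_orbit :: "(int \<Rightarrow> int) \<Rightarrow> int \<Rightarrow> int set"
  where "signed_orbit w x = {y. \<exists>i. \<bar>y\<bar> = \<bar>(w ^^ i) x\<bar>}"

lemma signed_perm_minus: "signed_perm w \<Longrightarrow> w (- i) = - w i"
  by (simp add: signed_perm_def)

lemma funpow_minus: "signed_perm w \<Longrightarrow> (w ^^ i) (- x) = - (w ^^ i) x"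
  by (induction i) (simp_all add: signed_perm_minus)

lemma funpow_sign: "signed_perm w \<Longrightarrow> s \<in> {1, -1} \<Longrightarrow> (w ^^ i) (s * x) = s * (w ^^ i) x"
  by (auto simp: funpow_minus)

lemma inj_funpow: "signed_perm w \<Longrightarrow> inj (w ^^ i)"
  by (simp add: signed_perm_def permutation_bijective bij_is_inj bij_betw_funpow)

lemma signed_perm_zero: "signed_perm w \<Longrightarrow> w 0 = 0"
  using signed_perm_minus[of w 0] by simp

lemma funpow_zero: "signed_perm w \<Longrightarrow> (w ^^ i) 0 = 0"
  by (induction i) (simp_all add: signed_perm_zero)

lemma funpow_eq_0_iff: "signed_perm w \<Longrightarrow> (w ^^ i) x = 0 \<longleftrightarrow> x = 0"
  using inj_funpow[of w i] funpow_zero[of w i] by (metis injD)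

lemma signed_perm_funpow: "signed_perm w \<Longrightarrow> signed_perm (w ^^ k)"
  using funpow_minus[of w k]
  by (auto simp: signed_perm_def permutation_funpow)

lemma abs_funpow_cong: "signed_perm w \<Longrightarrow> \<bar>x\<bar> = \<bar>y\<bar> \<Longrightarrow> \<bar>(w ^^ i) x\<bar> = \<bar>(w ^^ i) y\<bar>"
  by (auto simp: abs_eq_iff funpow_minus)

lemma abs_funpow_eq_iff:
  assumes "signed_perm w"
  shows "\<bar>(w ^^ i) x\<bar> = \<bar>(w ^^ i) y\<bar> \<longleftrightarrow> \<bar>x\<bar> = \<bar>y\<bar>"
proof -
  have "(w ^^ i) x = - (w ^^ i) y \<longleftrightarrow> x = - y"
    using inj_eq[OF inj_funpow[OF assms]] funpow_minus[OF assms] by metis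
  then show ?thesis
    using inj_eq[OF inj_funpow[OF assms]] by (simp add: abs_eq_iff)
qed

text \<open>A permutation of finite support brings every point back to itself, so some exponent
  qualifies and the \<open>LEAST\<close> is attained.\<close>

lemma cyc_len_spec:
  assumes "signed_perm w"
  shows "0 < cyc_len w x \<and> \<bar>(w ^^ cyc_len w x) x\<bar> = \<bar>x\<bar>"
proof -
  have "x \<in> orbit w x"
    using assms by (simp add: signed_perm_def permutation_self_in_orbit)
  then have "\<exists>j. 0 < j \<and> \<bar>(w ^^ j) x\<bar> = \<bar>x\<bar>"
    unfolding orbit_altdef by force
  then show ?thesis
    unfolding cyc_len_def by (rule LeastI_ex)
qed

lemmas cyc_len_pos = cyc_len_spec[THEN conjunct1]

lemma cyc_sign_cases: "cyc_sign w x \<in> {1, -1}"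
  by (simp add: cyc_sign_def)

lemma funpow_cyc_len: "signed_perm w \<Longrightarrow> (w ^^ cyc_len w x) x = cyc_sign w x * x"
  using cyc_len_spec[of w x] by (auto simp: cyc_sign_def abs_eq_iff)

lemma funpow_cyc_len_mult:
  "signed_perm w \<Longrightarrow> (w ^^ (cyc_len w x * q)) x = cyc_sign w x ^ q * x"
proof (induction q)
  case (Suc q)
  have "(w ^^ (cyc_len w x * Suc q)) x = (w ^^ (cyc_len w x * q)) ((w ^^ cyc_len w x) x)"
    by (simp only: mult_Suc_right add.commute[of "cyc_len w x"] funpow_add comp_apply)
  then show ?case
    using Suc cyc_sign_cases[of w x] by (simp add: funpow_cyc_len funpow_sign mult.assoc)
qed simp

lemma sign_power: "s \<in> {1, -1} \<Longrightarrow> s ^ q \<in> {1, -1 :: int}"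
  by (induction q) auto

text \<open>Divide the exponent by the cycle length: the full turns contribute only a sign.\<close>

lemma abs_funpow_mod:
  assumes "signed_perm w"
  shows "\<bar>(w ^^ i) x\<bar> = \<bar>(w ^^ (i mod cyc_len w x)) x\<bar>"
proof -
  let ?l = "cyc_len w x"
  have "(w ^^ i) x = (w ^^ (i mod ?l + ?l * (i div ?l))) x"
    by simp
  also have "\<dots> = (w ^^ (i mod ?l)) (cyc_sign w x ^ (i div ?l) * x)"
    by (simp only: funpow_add comp_apply funpow_cyc_len_mult[OF assms])
  also have "\<dots> = cyc_sign w x ^ (i div ?l) * (w ^^ (i mod ?l)) x"
    by (rule funpow_sign[OF assms sign_power[OF cyc_sign_cases]])
  finally show ?thesis
    using sign_power[OF cyc_sign_cases, of w x "i div ?l"] by auto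
qed

text \<open>A nonzero remainder would be a smaller positive exponent than the minimal one.\<close>

lemma abs_funpow_iff_dvd:
  assumes "signed_perm w"
  shows "\<bar>(w ^^ i) x\<bar> = \<bar>x\<bar> \<longleftrightarrow> cyc_len w x dvd i"
proof -
  have "i mod cyc_len w x < cyc_len w x"
    using cyc_len_pos[OF assms] by simp
  then have "\<bar>(w ^^ (i mod cyc_len w x)) x\<bar> = \<bar>x\<bar> \<longleftrightarrow> i mod cyc_len w x = 0"
    using not_less_Least[of "i mod cyc_len w x" "\<lambda>j. 0 < j \<and> \<bar>(w ^^ j) x\<bar> = \<bar>x\<bar>"]
    unfolding cyc_len_def[symmetric] by fastforce
  then show ?thesis
    unfolding abs_funpow_mod[OF assms, of i x] dvd_eq_mod_eq_0 .
qed

text \<open>Each full turn multiplies \<open>x\<close> by its sign, so the type of \<open>x\<close>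
  alone decides every relation between \<open>x\<close> and its iterates up to sign. This is what
  makes orbits of equal type isomorphic.\<close>

lemma funpow_eq_sign_iff:
  assumes "signed_perm w" "x \<noteq> 0" "s \<in> {1, -1}"
  shows "(w ^^ i) x = s * x \<longleftrightarrow> cyc_len w x dvd i \<and> cyc_sign w x ^ (i div cyc_len w x) = s"
proof (cases "cyc_len w x dvd i")
  case True
  then have "(w ^^ i) x = cyc_sign w x ^ (i div cyc_len w x) * x"
    using funpow_cyc_len_mult[OF assms(1), of x "i div cyc_len w x"] by simp
  with True assms(2) show ?thesis by simp
next
  case False
  then have "\<bar>(w ^^ i) x\<bar> \<noteq> \<bar>x\<bar>"
    by (simp add: abs_funpow_iff_dvd[OF assms(1)])
  moreover have "\<bar>s * x\<bar> = \<bar>x\<bar>" using assms(3) by auto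
  ultimately show ?thesis using False by (intro iffI) (simp_all only:, blast)
qed

text \<open>Replaces the minimum by divisibility: the exponents that fix \<bar>x\<bar> are exactly
  the multiples of the length, and these determine it. The later computations of types go through
  this rule.\<close>

lemma point_type_eqI:
  assumes "signed_perm w" "x \<noteq> 0" "\<theta> \<in> {1, -1}" "(w ^^ j) x = \<theta> * x"
    and "\<And>i. \<bar>(w ^^ i) x\<bar> = \<bar>x\<bar> \<longleftrightarrow> j dvd i"
  shows "point_type w x = (j, \<theta>)"
proof -
  have "cyc_len w x = j"
    using assms(5) abs_funpow_iff_dvd[OF assms(1), of _ x] by (meson dvd_antisym dvd_refl)
  moreover from this have "cyc_sign w x = \<theta>"
    using funpow_cyc_len[OF assms(1), of x] assms(2,4) by simp
  ultimately show ?thesis by (simp add: point_type_def)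
qed

lemma point_type_cong_abs:
  assumes "signed_perm w" "x \<noteq> 0" "\<bar>y\<bar> = \<bar>x\<bar>"
  shows "point_type w y = point_type w x"
proof -
  have "y = x \<or> y = - x" using assms(3) by (simp add: abs_eq_iff)
  then show ?thesis
    unfolding point_type_def[of w x]
    using assms cyc_sign_cases[of w x]
    by (intro point_type_eqI)
      (auto simp: funpow_minus funpow_cyc_len abs_funpow_iff_dvd)
qed

lemma point_type_funpow:
  assumes "signed_perm w" "x \<noteq> 0"
  shows "point_type w ((w ^^ i) x) = point_type w x"
proof -
  have comm: "(w ^^ m) ((w ^^ i) x) = (w ^^ i) ((w ^^ m) x)" for m
    by (metis add.commute comp_apply funpow_add)
  show ?thesis
    unfolding point_type_def[of w x]
    using assms cyc_sign_cases[of w x]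
    by (intro point_type_eqI)
      (auto simp: comm funpow_cyc_len funpow_sign funpow_eq_0_iff abs_funpow_eq_iff abs_funpow_iff_dvd
        simp del: funpow_swap1)
qed

text \<open>With d = gcd j k, the length j divides k * i iff j/d divides i, since j/d and k/d are
  coprime. And k * (j/d) = j * (k/d), so the new period makes k/d old turns, each contributing
  \<theta>.\<close>

lemma point_type_of_funpow:
  assumes "signed_perm w" "x \<noteq> 0" "k > 0" "point_type w x = (j, \<theta>)"
  shows "point_type (w ^^ k) x = (j div gcd j k, \<theta> ^ (k div gcd j k))"
proof -
  have j: "cyc_len w x = j" "cyc_sign w x = \<theta>" "j > 0" "\<theta> \<in> {1, -1}"
    using assms(4) cyc_len_pos[OF assms(1), of x] cyc_sign_cases[of w x] by (auto simp: point_type_def)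
  define d where "d = gcd j k"
  have d: "d > 0" "d dvd j" "d dvd k" using j(3) by (auto simp: d_def)
  have pow: "((w ^^ k) ^^ i) x = (w ^^ (k * i)) x" for i
    by (simp add: funpow_mult)
  have "k * (j div d) = j * (k div d)"
    using d by (metis div_mult_swap dvd_div_mult mult.commute)
  then have "((w ^^ k) ^^ (j div d)) x = \<theta> ^ (k div d) * x"
    using funpow_cyc_len_mult[OF assms(1), of x "k div d"] j by (simp add: pow)
  moreover have "j dvd k * i \<longleftrightarrow> j div d dvd i" for i
  proof -
    have "j dvd k * i \<longleftrightarrow> (j div d) * d dvd (k div d) * i * d"
      using d by (metis dvd_div_mult_self mult.assoc mult.commute)
    also have "\<dots> \<longleftrightarrow> j div d dvd (k div d) * i"
      using d by (subst dvd_times_right_cancel_iff) auto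
    also have "\<dots> \<longleftrightarrow> j div d dvd i"
      using assms(3) by (intro coprime_dvd_mult_right_iff) (simp add: d_def div_gcd_coprime)
    finally show ?thesis .
  qed
  ultimately show ?thesis
    using assms j sign_power[OF j(4)]
    by (intro point_type_eqI) (auto simp: signed_perm_funpow pow abs_funpow_iff_dvd d_def)
qed

section \<open>Signed orbits\<close>

lemma self_in_signed_orbit: "x \<in> signed_orbit w x"
  unfolding signed_orbit_def by (auto intro: exI[of _ 0])

lemma signed_orbit_eq:
  assumes "signed_perm w" "y \<in> signed_orbit w x"
  shows "signed_orbit w y = signed_orbit w x"
proof -
  obtain i where i: "\<bar>y\<bar> = \<bar>(w ^^ i) x\<bar>"
    using assms(2) by (auto simp: signed_orbit_def)
  have *: "\<bar>(w ^^ m) y\<bar> = \<bar>(w ^^ (m + i)) x\<bar>" for m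
    using abs_funpow_cong[OF assms(1) i, of m] by (simp add: funpow_add)
  let ?l = "cyc_len w x"
  \<comment> \<open>Going back from \<open>y\<close> to \<open>x\<close> subtracts \<open>i\<close>
    from the exponent; the added multiple of \<open>?l\<close> keeps the absolute value and prevents
    truncation of the natural subtraction.\<close>
  have "\<bar>(w ^^ m) x\<bar> = \<bar>(w ^^ (m + i * ?l - i)) y\<bar>" for m
  proof -
    have "m + i * ?l - i + i = m + i * ?l"
      using cyc_len_pos[OF assms(1), of x] by (simp add: trans_le_add2)
    then show ?thesis
      unfolding * using abs_funpow_mod[OF assms(1), of "m + i * ?l" x] abs_funpow_mod[OF assms(1), of m x]
      by simp
  qed
  with * show ?thesis
    unfolding signed_orbit_def by metis
qed

lemma signed_orbit_minus: "y \<in> signed_orbit w x \<Longrightarrow> - y \<in> signed_orbit w x"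
  by (simp add: signed_orbit_def)

lemma signed_orbitE:
  assumes "z \<in> signed_orbit w x"
  obtains i s where "s \<in> {1, -1 :: int}" "z = s * (w ^^ i) x"
proof -
  obtain i where "\<bar>z\<bar> = \<bar>(w ^^ i) x\<bar>"
    using assms by (auto simp: signed_orbit_def)
  then show thesis
    using that[of 1 i] that[of "-1" i] by (auto simp: abs_eq_iff)
qed

lemma signed_orbit_step:
  assumes "signed_perm w" "y \<in> signed_orbit w x"
  shows "w y \<in> signed_orbit w x"
proof -
  obtain i where "\<bar>y\<bar> = \<bar>(w ^^ i) x\<bar>"
    using assms(2) by (auto simp: signed_orbit_def)
  then have "\<bar>w y\<bar> = \<bar>(w ^^ Suc i) x\<bar>"
    using abs_funpow_cong[OF assms(1), of y "(w ^^ i) x" 1] by simp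
  then show ?thesis
    unfolding signed_orbit_def by blast
qed

lemma signed_orbit_step_iff:
  assumes "signed_perm w"
  shows "w y \<in> signed_orbit w x \<longleftrightarrow> y \<in> signed_orbit w x"
proof
  assume "w y \<in> signed_orbit w x"
  moreover have "signed_orbit w (w y) = signed_orbit w y"
    using assms by (intro signed_orbit_eq signed_orbit_step self_in_signed_orbit)
  ultimately show "y \<in> signed_orbit w x"
    using signed_orbit_eq[OF assms] self_in_signed_orbit by metis
qed (rule signed_orbit_step[OF assms])

lemma signed_orbit_minus_iff: "- y \<in> signed_orbit w x \<longleftrightarrow> y \<in> signed_orbit w x"
  using signed_orbit_minus[of y w x] signed_orbit_minus[of "- y" w x] by auto

lemma sign_funpow_in_signed_orbit: "s \<in> {1, -1 :: int} \<Longrightarrow> s * (w ^^ i) x \<in> signed_orbit w x"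
  unfolding signed_orbit_def by (auto intro!: exI[of _ i])

lemma point_type_signed_orbit:
  assumes "signed_perm w" "x \<noteq> 0" "y \<in> signed_orbit w x"
  shows "point_type w y = point_type w x"
proof -
  obtain i where "\<bar>y\<bar> = \<bar>(w ^^ i) x\<bar>"
    using assms(3) by (auto simp: signed_orbit_def)
  then have "point_type w y = point_type w ((w ^^ i) x)"
    using assms by (intro point_type_cong_abs) (simp_all add: funpow_eq_0_iff)
  then show ?thesis
    using point_type_funpow[OF assms(1,2)] by simp
qed

text \<open>The points \<open>s * (w ^^ i) x\<close> with \<open>i\<close> below the length and
  \<open>s\<close> a sign are distinct and exhaust the orbit.\<close>

lemma card_signed_orbit:
  assumes "signed_perm w" "x \<noteq> 0"
  shows "card (signed_orbit w x) = 2 * cyc_len w x" "finite (signed_orbit w x)"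
proof -
  let ?f = "\<lambda>(i, s). s * (w ^^ i) x"
  let ?I = "{..<cyc_len w x} \<times> {1, -1 :: int}"
  have le: "i = i'" if "\<bar>(w ^^ i) x\<bar> = \<bar>(w ^^ i') x\<bar>" "i' < cyc_len w x" "i \<le> i'" for i i'
  proof -
    have "(w ^^ (i + (i' - i))) x = (w ^^ i) ((w ^^ (i' - i)) x)"
      by (simp only: funpow_add comp_apply)
    with that have "\<bar>(w ^^ i) ((w ^^ (i' - i)) x)\<bar> = \<bar>(w ^^ i) x\<bar>"
      by simp
    then have "cyc_len w x dvd i' - i"
      by (simp only: abs_funpow_eq_iff[OF assms(1)] abs_funpow_iff_dvd[OF assms(1)])
    then show ?thesis using that(2,3) by (auto dest: dvd_imp_le)
  qed
  have inj: "inj_on ?f ?I"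
  proof (rule inj_onI, clarify)
    fix i s i' s' assume s: "i < cyc_len w x" "i' < cyc_len w x" "s \<in> {1, -1 :: int}" "s' \<in> {1, -1}"
      and eq: "s * (w ^^ i) x = s' * (w ^^ i') x"
    have "\<bar>(w ^^ i) x\<bar> = \<bar>(w ^^ i') x\<bar>"
      using arg_cong[OF eq, of abs] s(3,4) by (elim insertE emptyE) simp_all
    then have "i = i'" using le[of i i'] le[of i' i] s(1,2) by (cases "i \<le> i'") simp_all
    moreover from this have "s = s'" using eq assms by (simp add: funpow_eq_0_iff)
    ultimately show "i = i' \<and> s = s'" by simp
  qed
  have img: "?f ` ?I = signed_orbit w x"
  proof (intro equalityI subsetI)
    fix y assume "y \<in> signed_orbit w x"
    then obtain i where "\<bar>y\<bar> = \<bar>(w ^^ i) x\<bar>" by (auto simp: signed_orbit_def)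
    then have "\<bar>y\<bar> = \<bar>(w ^^ (i mod cyc_len w x)) x\<bar>"
      using abs_funpow_mod[OF assms(1), of i x] by (rule trans)
    moreover have "i mod cyc_len w x < cyc_len w x"
      using cyc_len_pos[OF assms(1)] by simp
    ultimately show "y \<in> ?f ` ?I"
      by (intro image_eqI[of _ _ "(i mod cyc_len w x, if y = (w ^^ (i mod cyc_len w x)) x then 1 else -1)"])
        (auto simp: abs_eq_iff)
  next
    fix y assume "y \<in> ?f ` ?I"
    then show "y \<in> signed_orbit w x"
      using sign_funpow_in_signed_orbit by fast
  qed
  show "finite (signed_orbit w x)"
    unfolding img[symmetric] by simp
  have "card ?I = 2 * cyc_len w x" by (simp add: card_cartesian_product)
  then show "card (signed_orbit w x) = 2 * cyc_len w x"
    using card_image[OF inj] img by simp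
qed

section \<open>Isomorphisms of signed permutations\<close>

definition signed_invariant :: "(int \<Rightarrow> int) \<Rightarrow> int set \<Rightarrow> bool"
  where "signed_invariant w S \<longleftrightarrow> finite S \<and> 0 \<notin> S \<and> (\<forall>x\<in>S. - x \<in> S \<and> w x \<in> S)"

definition point_types :: "(int \<Rightarrow> int) \<Rightarrow> int set \<Rightarrow> (nat \<times> int) multiset"
  where "point_types w S = image_mset (point_type w) (mset_set {x \<in> S. 0 < x})"

text \<open>Requiring the identity outside \<open>S\<close> makes each isomorphism a single function
  on the integers, so that \<open>card\<close> counts isomorphisms.\<close>

definition signed_isos :: "(int \<Rightarrow> int) \<Rightarrow> int set \<Rightarrow> (int \<Rightarrow> int) \<Rightarrow> int set \<Rightarrow> (int \<Rightarrow> int) set"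
  where "signed_isos w S w' S' =
    {\<sigma>. (\<forall>i. i \<notin> S \<longrightarrow> \<sigma> i = i) \<and> bij_betw \<sigma> S S' \<and>
        (\<forall>i\<in>S. \<sigma> (- i) = - \<sigma> i \<and> \<sigma> (w i) = w' (\<sigma> i))}"

text \<open>The multisets arising as \<^const>\<open>point_types\<close>: a cycle of length \<open>j\<close> contributes \<open>j\<close>
  copies of its type \<open>(j, \<theta>)\<close>.\<close>

definition valid_types :: "(nat \<times> int) multiset \<Rightarrow> bool"
  where "valid_types M \<longleftrightarrow> (\<forall>v\<in>#M. 0 < fst v \<and> snd v \<in> {1, -1} \<and> fst v dvd count M v)"

text \<open>For v = (j, \<theta>) the quotient \<open>count M v div fst v\<close> is the number b of
  cycles of type v. They can be permuted in b! ways, and each has 2j automorphisms.\<close>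

definition centralizer_size :: "(nat \<times> int) multiset \<Rightarrow> nat"
  where "centralizer_size M =
    (\<Prod>v\<in>set_mset M. fact (count M v div fst v) * (2 * fst v) ^ (count M v div fst v))"

lemma centralizer_size_superset:
  assumes "finite A" "set_mset M \<subseteq> A"
  shows "centralizer_size M =
    (\<Prod>v\<in>A. fact (count M v div fst v) * (2 * fst v) ^ (count M v div fst v))"
  unfolding centralizer_size_def using assms
  by (intro prod.mono_neutral_left) (auto simp: not_in_iff)

lemma centralizer_size_empty [simp]: "centralizer_size {#} = 1"
  by (simp add: centralizer_size_def)

text \<open>Only the factor at v changes: going from b to b + 1 cycles of length j multiplies b!
  (2j)^b by (b + 1) 2j, and j b is the multiplicity of v.\<close>

lemma centralizer_size_add:
  assumes "0 < fst v" "fst v dvd count M v"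
  shows "centralizer_size (M + replicate_mset (fst v) v) = 2 * (count M v + fst v) * centralizer_size M"
proof -
  let ?N = "M + replicate_mset (fst v) v"
  let ?A = "insert v (set_mset M)"
  let ?f = "\<lambda>M v. fact (count M v div fst v) * (2 * fst v) ^ (count M v div fst v) :: nat"
  obtain b where b: "count M v = fst v * b" using assms(2) by auto
  have "count ?N v = fst v * Suc b" using b by simp
  then have v: "?f ?N v = 2 * (count M v + fst v) * ?f M v"
    using assms(1) unfolding b by (simp only: nonzero_mult_div_cancel_left) (simp add: algebra_simps)
  have "centralizer_size ?N = (\<Prod>u\<in>?A. ?f ?N u)"
    by (rule centralizer_size_superset) auto
  also have "\<dots> = ?f ?N v * (\<Prod>u\<in>?A - {v}. ?f ?N u)"
    by (rule prod.remove) auto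
  also have "(\<Prod>u\<in>?A - {v}. ?f ?N u) = (\<Prod>u\<in>?A - {v}. ?f M u)"
    by (rule prod.cong) auto
  also have "?f ?N v * \<dots> = 2 * (count M v + fst v) * (?f M v * (\<Prod>u\<in>?A - {v}. ?f M u))"
    unfolding v by simp
  also have "?f M v * (\<Prod>u\<in>?A - {v}. ?f M u) = (\<Prod>u\<in>?A. ?f M u)"
    by (rule prod.remove[symmetric]) auto
  also have "\<dots> = centralizer_size M"
    by (rule centralizer_size_superset[symmetric]) auto
  finally show ?thesis .
qed

lemma centralizer_size_pos: "valid_types M \<Longrightarrow> 0 < centralizer_size M"
  by (auto simp: centralizer_size_def valid_types_def intro!: prod_pos)

lemma valid_types_dvd: "valid_types M \<Longrightarrow> fst v dvd count M v"
  by (cases "v \<in># M") (auto simp: valid_types_def not_in_iff)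

lemma valid_types_add:
  assumes "valid_types M" "0 < fst v" "snd v \<in> {1, -1}"
  shows "valid_types (M + replicate_mset (fst v) v)"
  using assms valid_types_dvd[OF assms(1), of v]
  by (auto simp: valid_types_def split: if_splits)

lemma valid_types_diff:
  assumes "valid_types M" "v \<in># M"
  shows "replicate_mset (fst v) v \<subseteq># M" "valid_types (M - replicate_mset (fst v) v)"
proof -
  have "fst v \<le> count M v"
    using assms by (auto simp: valid_types_def intro!: dvd_imp_le)
  then show "replicate_mset (fst v) v \<subseteq># M"
    by (simp add: count_le_replicate_mset_subset_eq)
  show "valid_types (M - replicate_mset (fst v) v)"
    using assms(1) by (auto simp: valid_types_def dest!: in_diffD)
qed

section \<open>Removing an orbit from an invariant set\<close>

lemma signed_invariant_funpow: "signed_invariant w S \<Longrightarrow> x \<in> S \<Longrightarrow> (w ^^ i) x \<in> S"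
  by (induction i) (auto simp: signed_invariant_def)

lemma signed_orbit_subset:
  "signed_invariant w S \<Longrightarrow> x \<in> S \<Longrightarrow> signed_orbit w x \<subseteq> S"
  by (auto elim!: signed_orbitE simp: signed_invariant_funpow)
    (auto simp: signed_invariant_def signed_invariant_funpow[unfolded signed_invariant_def])

lemma signed_invariant_Diff:
  assumes "signed_perm w" "signed_invariant w S"
  shows "signed_invariant w (S - signed_orbit w x)"
  using assms by (auto simp: signed_invariant_def signed_orbit_step_iff signed_orbit_minus_iff)

lemma signed_invariant_signed_orbit:
  "signed_perm w \<Longrightarrow> x \<noteq> 0 \<Longrightarrow> signed_invariant w (signed_orbit w x)"
  unfolding signed_invariant_def
  by (auto simp: card_signed_orbit signed_orbit_minus signed_orbit_step)
    (auto simp: signed_orbit_def funpow_eq_0_iff)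

lemma card_symmetric:
  fixes S :: "int set"
  assumes "finite S" "0 \<notin> S" "\<And>x. x \<in> S \<Longrightarrow> - x \<in> S"
  shows "card S = 2 * card {x \<in> S. 0 < x}"
proof -
  let ?P = "{x \<in> S. 0 < x}" and ?N = "{x \<in> S. x < 0}"
  have "bij_betw uminus ?P ?N"
    using assms(3) by (intro bij_betwI[of _ _ _ uminus]) auto
  then have "card ?P = card ?N" by (rule bij_betw_same_card)
  moreover have "card S = card ?P + card ?N"
  proof -
    have "x \<in> ?P \<union> ?N" if "x \<in> S" for x
      using that assms(2) by (cases x "0::int" rule: linorder_cases) auto
    then have "S = ?P \<union> ?N" by auto
    moreover have "card (?P \<union> ?N) = card ?P + card ?N"
      using assms(1) by (intro card_Un_disjoint) auto
    ultimately show ?thesis by simp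
  qed
  ultimately show ?thesis by simp
qed

text \<open>The factor 2 arises because \<open>point_types\<close> sees positive points only, while
  x and -x have the same type.\<close>

lemma count_point_types:
  assumes "signed_perm w" "signed_invariant w S"
  shows "2 * count (point_types w S) v = card {x \<in> S. point_type w x = v}"
proof -
  have S: "finite S" "0 \<notin> S" "\<And>x. x \<in> S \<Longrightarrow> - x \<in> S"
    using assms(2) by (auto simp: signed_invariant_def)
  have "count (point_types w S) v = card {x \<in> {x \<in> S. point_type w x = v}. 0 < x}"
    using S(1) by (auto simp: point_types_def count_image_mset_eq_card_vimage intro!: arg_cong[of _ _ card])
  moreover have "point_type w (- x) = point_type w x" if "x \<in> S" for x
    using that S(2) by (intro point_type_cong_abs assms(1)) auto
  ultimately show ?thesis
    using S by (subst card_symmetric) auto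
qed

text \<open>The type is constant on a signed orbit, and half of the points of the orbit are
  positive.\<close>

lemma point_types_Diff:
  assumes "signed_perm w" "signed_invariant w S" "x \<in> S"
  shows "point_types w S =
    point_types w (S - signed_orbit w x) + replicate_mset (cyc_len w x) (point_type w x)"
proof -
  have x: "x \<noteq> 0" using assms by (auto simp: signed_invariant_def)
  have fin: "finite S" using assms by (auto simp: signed_invariant_def)
  let ?O = "signed_orbit w x"
  have sub: "?O \<subseteq> S" by (rule signed_orbit_subset[OF assms(2,3)])
  have "mset_set {y \<in> S. 0 < y} = mset_set {y \<in> S - ?O. 0 < y} + mset_set {y \<in> ?O. 0 < y}"
  proof -
    have "{y \<in> S. 0 < y} = {y \<in> S - ?O. 0 < y} \<union> {y \<in> ?O. 0 < y}"
      using sub by auto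
    then show ?thesis
      using fin card_signed_orbit(2)[OF assms(1) x] by (simp add: mset_set_Union Int_def) 
  qed
  moreover have "image_mset (point_type w) (mset_set {y \<in> ?O. 0 < y})
      = image_mset (\<lambda>_. point_type w x) (mset_set {y \<in> ?O. 0 < y})"
    using card_signed_orbit(2)[OF assms(1) x] point_type_signed_orbit[OF assms(1) x]
    by (intro image_mset_cong) auto
  moreover have "card {y \<in> ?O. 0 < y} = cyc_len w x"
    using card_symmetric[of ?O] signed_invariant_signed_orbit[OF assms(1) x]
      card_signed_orbit(1)[OF assms(1) x] by (auto simp: signed_invariant_def)
  ultimately show ?thesis
    by (simp add: point_types_def image_mset_const_eq)
qed

lemma valid_point_types:
  assumes "signed_perm w" "signed_invariant w S"
  shows "valid_types (point_types w S)"
  using assms(2)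
proof (induction "card S" arbitrary: S rule: less_induct)
  case less
  show ?case
  proof (cases "S = {}")
    case True
    then show ?thesis by (simp add: point_types_def valid_types_def)
  next
    case False
    then obtain x where x: "x \<in> S" by auto
    have "card (S - signed_orbit w x) < card S"
      using x less.prems self_in_signed_orbit[of x w]
      by (intro psubset_card_mono) (auto simp: signed_invariant_def)
    then have "valid_types (point_types w (S - signed_orbit w x))"
      using less signed_invariant_Diff[OF assms(1)] by blast
    then show ?thesis
      using valid_types_add[of _ "point_type w x"] cyc_len_pos[OF assms(1)] cyc_sign_cases
      unfolding point_types_Diff[OF assms(1) less.prems x] by (simp add: point_type_def)
  qed
qed

section \<open>Existence and number of isomorphisms\<close>

lemma signed_isos_sign_funpow:
  assumes "signed_invariant w S" "\<sigma> \<in> signed_isos w S w' S'" "x \<in> S" "s \<in> {1, -1}"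
  shows "\<sigma> (s * (w ^^ i) x) = s * (w' ^^ i) (\<sigma> x)"
proof -
  have "\<sigma> ((w ^^ i) x) = (w' ^^ i) (\<sigma> x)"
    using assms signed_invariant_funpow[OF assms(1,3)]
    by (induction i) (auto simp: signed_isos_def)
  moreover have "\<sigma> (- (w ^^ i) x) = - \<sigma> ((w ^^ i) x)"
    using assms(2) signed_invariant_funpow[OF assms(1,3)] by (auto simp: signed_isos_def)
  ultimately show ?thesis using assms(4) by auto
qed

text \<open>By injectivity, \<open>x\<close> and its image satisfy the same relations between a
  point and its iterates up to sign, and these determine the type.\<close>

lemma signed_isos_point_type:
  assumes "signed_perm w" "signed_invariant w S" "signed_perm w'" "signed_invariant w' S'"
    and "\<sigma> \<in> signed_isos w S w' S'" "x \<in> S"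
  shows "point_type w' (\<sigma> x) = point_type w x"
proof -
  have inj: "inj_on \<sigma> S" and S': "\<sigma> x \<in> S'"
    using assms(5,6) by (auto simp: signed_isos_def bij_betw_def)
  have 0: "x \<noteq> 0" "\<sigma> x \<noteq> 0"
    using assms S' by (auto simp: signed_invariant_def)
  have S: "s * (w ^^ i) x \<in> S" if "s \<in> {1, -1}" for s i
    using that assms(2,6) signed_invariant_funpow[OF assms(2,6)]
    by (auto simp: signed_invariant_def)
  have *: "(w' ^^ i) (\<sigma> x) = s * \<sigma> x \<longleftrightarrow> (w ^^ i) x = s * x" if "s \<in> {1, -1}" for s i
    using inj_on_eq_iff[OF inj S[of 1 i] S[of s 0]] that
      signed_isos_sign_funpow[OF assms(2,5,6), of 1 i] signed_isos_sign_funpow[OF assms(2,5,6), of s 0]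
    by simp
  have "\<bar>(w' ^^ i) (\<sigma> x)\<bar> = \<bar>\<sigma> x\<bar> \<longleftrightarrow> cyc_len w x dvd i" for i
    using *[of 1 i] *[of "-1" i] abs_funpow_iff_dvd[OF assms(1), of i x] by (simp add: abs_eq_iff)
  moreover have "(w' ^^ cyc_len w x) (\<sigma> x) = cyc_sign w x * \<sigma> x"
    using * cyc_sign_cases funpow_cyc_len[OF assms(1)] by simp
  ultimately show ?thesis
    unfolding point_type_def[of w x]
    using assms(3) 0 cyc_sign_cases by (intro point_type_eqI) auto
qed

lemma signed_isos_point_types:
  assumes "signed_perm w" "signed_invariant w S" "signed_perm w'" "signed_invariant w' S'"
    and "\<sigma> \<in> signed_isos w S w' S'"
  shows "point_types w' S' = point_types w S"
proof (rule multiset_eqI)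
  fix v
  have bij: "bij_betw \<sigma> S S'" using assms(5) by (simp add: signed_isos_def)
  have "bij_betw \<sigma> {x \<in> S. point_type w x = v} {x \<in> S'. point_type w' x = v}"
    unfolding bij_betw_def
  proof
    show "inj_on \<sigma> {x \<in> S. point_type w x = v}"
      using bij by (auto simp: bij_betw_def inj_on_def)
    have "S' = \<sigma> ` S" using bij by (simp add: bij_betw_def)
    then show "\<sigma> ` {x \<in> S. point_type w x = v} = {x \<in> S'. point_type w' x = v}"
      using signed_isos_point_type[OF assms] by auto
  qed
  then have "card {x \<in> S. point_type w x = v} = card {x \<in> S'. point_type w' x = v}"
    by (rule bij_betw_same_card)
  then show "count (point_types w' S') v = count (point_types w S) v"
    using count_point_types[OF assms(1,2), of v] count_point_types[OF assms(3,4), of v] by simp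
qed

lemma signed_isos_signed_orbit:
  assumes "signed_invariant w S" "\<sigma> \<in> signed_isos w S w' S'" "x \<in> S"
  shows "\<sigma> ` signed_orbit w x = signed_orbit w' (\<sigma> x)"
proof (intro equalityI subsetI)
  fix z assume "z \<in> \<sigma> ` signed_orbit w x"
  then obtain y where y: "y \<in> signed_orbit w x" "z = \<sigma> y" by auto
  then obtain i s where "s \<in> {1, -1}" "y = s * (w ^^ i) x" by (elim signed_orbitE)
  then show "z \<in> signed_orbit w' (\<sigma> x)"
    using signed_isos_sign_funpow[OF assms] sign_funpow_in_signed_orbit y(2) by metis
next
  fix z assume "z \<in> signed_orbit w' (\<sigma> x)"
  then obtain i s where s: "s \<in> {1, -1}" "z = s * (w' ^^ i) (\<sigma> x)" by (elim signed_orbitE)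
  then have "z = \<sigma> (s * (w ^^ i) x)"
    using signed_isos_sign_funpow[OF assms] by simp
  then show "z \<in> \<sigma> ` signed_orbit w x"
    using sign_funpow_in_signed_orbit[OF s(1)] by blast
qed

text \<open>Cancelling the smaller power leaves a relation of the form
  \<open>(w ^^ m) x = (s * t) * x\<close>, which depends only on the type. The equivalence yields
  both well-definedness and injectivity of the map between two orbits.\<close>

lemma sign_funpow_eq_iff:
  assumes "signed_perm w" "signed_perm w'" "x \<noteq> 0" "y \<noteq> 0" "point_type w x = point_type w' y"
    and "s \<in> {1, -1}" "t \<in> {1, -1}"
  shows "s * (w ^^ i) x = t * (w ^^ j) x \<longleftrightarrow> s * (w' ^^ i) y = t * (w' ^^ j) y"
proof -
  have *: "s * (u ^^ i) z = t * (u ^^ j) z \<longleftrightarrow>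
      (if i \<le> j then (u ^^ (j - i)) z = (s * t) * z else (u ^^ (i - j)) z = (s * t) * z)"
    if u: "signed_perm u" for u z
  proof -
    have 1: "s * (u ^^ i) z = t * (u ^^ j) z \<longleftrightarrow> (u ^^ (j - i)) z = (s * t) * z"
      if "i \<le> j" "s \<in> {1, -1}" "t \<in> {1, -1}" for s t :: int and i j
    proof -
      have "(u ^^ (i + (j - i))) z = (u ^^ i) ((u ^^ (j - i)) z)"
        by (simp only: funpow_add comp_apply)
      with that(1) have j: "(u ^^ j) z = (u ^^ i) ((u ^^ (j - i)) z)" by simp
      have "s * (u ^^ i) z = t * (u ^^ j) z \<longleftrightarrow> (u ^^ j) z = (s * t) * (u ^^ i) z"
        using that(2,3) by auto
      also have "\<dots> \<longleftrightarrow> (u ^^ i) ((u ^^ (j - i)) z) = (u ^^ i) ((s * t) * z)"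
        using funpow_sign[OF u, of "s * t"] that(2,3) unfolding j by auto
      also have "\<dots> \<longleftrightarrow> (u ^^ (j - i)) z = (s * t) * z"
        by (rule inj_eq[OF inj_funpow[OF u]])
      finally show ?thesis .
    qed
    show ?thesis
      \<comment> \<open>The case j < i is the same statement with the two sides exchanged.\<close>
      using 1[of i j s t] 1[of j i t s] assms(6,7) by (auto simp: mult.commute)
  qed
  have "s * t \<in> {1, -1}" using assms(6,7) by auto
  with assms(5) have "(w ^^ m) x = (s * t) * x \<longleftrightarrow> (w' ^^ m) y = (s * t) * y" for m
    using funpow_eq_sign_iff[OF assms(1,3)] funpow_eq_sign_iff[OF assms(2,4)]
    by (simp add: point_type_def)
  then show ?thesis
    unfolding *[OF assms(1)] *[OF assms(2)] by simp
qed

text \<open>The isomorphism sends \<open>s * (w ^^ i) x\<close> to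
  \<open>s * (w' ^^ i) y\<close>.\<close>

lemma signed_orbit_iso_exists:
  assumes "signed_perm w" "signed_perm w'" "x \<noteq> 0" "y \<noteq> 0" "point_type w x = point_type w' y"
  obtains \<tau> where "\<tau> \<in> signed_isos w (signed_orbit w x) w' (signed_orbit w' y)" "\<tau> x = y"
proof -
  note iff = sign_funpow_eq_iff[OF assms]
  \<comment> \<open>A point has many representations by a sign and an exponent. One is chosen here,
    and \<open>val\<close> then shows that the value does not depend on the choice.\<close>
  have "\<forall>z. \<exists>u. (z \<in> signed_orbit w x \<longrightarrow> (\<exists>i s. s \<in> {1, -1} \<and> z = s * (w ^^ i) x \<and> u = s * (w' ^^ i) y))
      \<and> (z \<notin> signed_orbit w x \<longrightarrow> u = z)"
    by (metis signed_orbitE)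
  then obtain \<tau> where \<tau>: "\<And>z. z \<in> signed_orbit w x \<Longrightarrow>
        \<exists>i s. s \<in> {1, -1} \<and> z = s * (w ^^ i) x \<and> \<tau> z = s * (w' ^^ i) y"
      "\<And>z. z \<notin> signed_orbit w x \<Longrightarrow> \<tau> z = z"
    by metis
  have val: "\<tau> (s * (w ^^ i) x) = s * (w' ^^ i) y" if "s \<in> {1, -1}" for s i
    using \<tau>(1)[OF sign_funpow_in_signed_orbit[OF that, where w = w and i = i and x = x]] iff that
    by metis
  have val1: "\<tau> ((w ^^ i) x) = (w' ^^ i) y" for i
    using val[of 1 i] by simp
  show thesis
  proof (rule that)
    show "\<tau> x = y" using val[of 1 0] by simp
    have inj: "inj_on \<tau> (signed_orbit w x)"
    proof (rule inj_onI)
      fix z z' assume "z \<in> signed_orbit w x" "z' \<in> signed_orbit w x" and eq: "\<tau> z = \<tau> z'"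
      then show "z = z'" by (elim signed_orbitE) (metis val iff)
    qed
    have img: "\<tau> ` signed_orbit w x = signed_orbit w' y"
    proof (intro equalityI subsetI)
      fix z assume "z \<in> \<tau> ` signed_orbit w x"
      then show "z \<in> signed_orbit w' y"
        using \<tau>(1) sign_funpow_in_signed_orbit by fastforce
    next
      fix z assume "z \<in> signed_orbit w' y"
      then obtain s i where "s \<in> {1, -1}" "z = s * (w' ^^ i) y" by (elim signed_orbitE)
      then show "z \<in> \<tau> ` signed_orbit w x"
        using val sign_funpow_in_signed_orbit by (metis image_eqI)
    qed
    have "\<tau> (- z) = - \<tau> z \<and> \<tau> (w z) = w' (\<tau> z)" if z: "z \<in> signed_orbit w x" for z
    proof -
      from z obtain s i where s: "s \<in> {1, -1}" "z = s * (w ^^ i) x" by (elim signed_orbitE)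
      have "- z = (- s) * (w ^^ i) x" "w z = s * (w ^^ Suc i) x"
        using s funpow_sign[OF assms(1), of s 1] by auto
      moreover have "w' (\<tau> z) = s * (w' ^^ Suc i) y"
        using val[OF s(1), of i] funpow_sign[OF assms(2) s(1), of 1] s(2) by simp
      moreover have "- s \<in> {1, -1}" using s(1) by auto
      ultimately show ?thesis
        using val[of s i] val[of "- s" i] val[of s "Suc i"] s by (metis mult_minus_left)
    qed
    then show "\<tau> \<in> signed_isos w (signed_orbit w x) w' (signed_orbit w' y)"
      using inj img \<tau>(2) by (simp add: signed_isos_def bij_betw_def)
  qed
qed

text \<open>Resetting \<sigma> to the identity on the removed orbit restores the convention for
  points outside the domain.\<close>

lemma signed_isos_restrict:
  assumes "signed_perm w" "signed_invariant w S" "\<sigma> \<in> signed_isos w S w' S'" "x \<in> S"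
  shows "(\<lambda>i. if i \<in> signed_orbit w x then i else \<sigma> i) \<in>
    signed_isos w (S - signed_orbit w x) w' (S' - signed_orbit w' (\<sigma> x))"
proof -
  let ?r = "\<lambda>i. if i \<in> signed_orbit w x then i else \<sigma> i"
  have bij: "bij_betw \<sigma> S S'" using assms(3) by (simp add: signed_isos_def)
  then have "bij_betw \<sigma> (S - signed_orbit w x) (S' - signed_orbit w' (\<sigma> x))"
    using signed_orbit_subset[OF assms(2,4)]
    unfolding signed_isos_signed_orbit[OF assms(2-4), symmetric]
    by (auto simp: bij_betw_def inj_on_diff inj_on_image_set_diff[of \<sigma> S S])
  then have "bij_betw ?r (S - signed_orbit w x) (S' - signed_orbit w' (\<sigma> x))"
    by (rule bij_betw_cong[THEN iffD1, rotated]) auto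
  then show ?thesis
    using assms(3) by (auto simp: signed_isos_def signed_orbit_step_iff[OF assms(1)] signed_orbit_minus_iff)
qed

lemma signed_isos_combine:
  assumes "signed_perm w" "signed_invariant w S" "signed_invariant w' S'" "x \<in> S" "y \<in> S'"
    and "\<tau> \<in> signed_isos w (signed_orbit w x) w' (signed_orbit w' y)"
    and "\<rho> \<in> signed_isos w (S - signed_orbit w x) w' (S' - signed_orbit w' y)"
  shows "(\<lambda>i. if i \<in> signed_orbit w x then \<tau> i else \<rho> i) \<in> signed_isos w S w' S'"
proof -
  let ?r = "\<lambda>i. if i \<in> signed_orbit w x then \<tau> i else \<rho> i"
  have sub: "signed_orbit w x \<subseteq> S" "signed_orbit w' y \<subseteq> S'"
    using assms signed_orbit_subset by blast+
  have "bij_betw ?r (signed_orbit w x \<union> (S - signed_orbit w x))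
      (signed_orbit w' y \<union> (S' - signed_orbit w' y))"
  proof (rule bij_betw_combine)
    show "bij_betw ?r (signed_orbit w x) (signed_orbit w' y)"
      using assms(6) by (auto simp: signed_isos_def cong: bij_betw_cong)
    have "bij_betw \<rho> (S - signed_orbit w x) (S' - signed_orbit w' y)"
      using assms(7) by (simp add: signed_isos_def)
    then show "bij_betw ?r (S - signed_orbit w x) (S' - signed_orbit w' y)"
      by (rule bij_betw_cong[THEN iffD1, rotated]) auto
  qed auto
  then have "bij_betw ?r S S'"
    using sub by (simp add: Un_absorb1)
  moreover have "?r i = i" if "i \<notin> S" for i
    using that sub assms(7) by (auto simp: signed_isos_def)
  ultimately show ?thesis
    using assms(6,7)
    by (auto simp: signed_isos_def signed_orbit_step_iff[OF assms(1)] signed_orbit_minus_iff)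
qed

text \<open>All isomorphisms sending \<open>x\<close> to \<open>y\<close> agree on the orbit of
  \<open>x\<close> with one fixed \<tau>, so restriction to the complement is a bijection; its
  inverse glues \<tau> back in.\<close>

lemma card_signed_isos_point:
  assumes "signed_perm w" "signed_invariant w S" "signed_perm w'" "signed_invariant w' S'"
    and "x \<in> S" "y \<in> S'" "point_type w x = point_type w' y"
  shows "card {\<sigma> \<in> signed_isos w S w' S'. \<sigma> x = y} =
    card (signed_isos w (S - signed_orbit w x) w' (S' - signed_orbit w' y))"
proof -
  have 0: "x \<noteq> 0" "y \<noteq> 0" using assms by (auto simp: signed_invariant_def)
  obtain \<tau> where \<tau>: "\<tau> \<in> signed_isos w (signed_orbit w x) w' (signed_orbit w' y)" "\<tau> x = y"
    using signed_orbit_iso_exists[OF assms(1,3) 0 assms(7)] .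
  let ?O = "signed_orbit w x"
  have eq: "\<sigma> z = \<tau> z" if \<sigma>: "\<sigma> \<in> signed_isos w S w' S'" "\<sigma> x = y" and z: "z \<in> ?O" for \<sigma> z
  proof -
    from z obtain s i where s: "s \<in> {1, -1}" "z = s * (w ^^ i) x" by (elim signed_orbitE)
    then show ?thesis
      using signed_isos_sign_funpow[OF assms(2) \<sigma>(1) assms(5) s(1)]
        signed_isos_sign_funpow[OF signed_invariant_signed_orbit[OF assms(1) 0(1)] \<tau>(1)
          self_in_signed_orbit s(1)] \<sigma>(2) \<tau>(2) by simp
  qed
  have "bij_betw (\<lambda>\<sigma> i. if i \<in> ?O then i else \<sigma> i) {\<sigma> \<in> signed_isos w S w' S'. \<sigma> x = y}
      (signed_isos w (S - ?O) w' (S' - signed_orbit w' y))"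
  proof (rule bij_betwI[where g = "\<lambda>\<rho> i. if i \<in> ?O then \<tau> i else \<rho> i"])
    show "(\<lambda>\<sigma> i. if i \<in> ?O then i else \<sigma> i) \<in> {\<sigma> \<in> signed_isos w S w' S'. \<sigma> x = y} \<rightarrow>
        signed_isos w (S - ?O) w' (S' - signed_orbit w' y)"
      using signed_isos_restrict[OF assms(1,2) _ assms(5)] by blast
    show "(\<lambda>\<rho> i. if i \<in> ?O then \<tau> i else \<rho> i) \<in> signed_isos w (S - ?O) w' (S' - signed_orbit w' y) \<rightarrow>
        {\<sigma> \<in> signed_isos w S w' S'. \<sigma> x = y}"
      using signed_isos_combine[OF assms(1,2,4,5,6) \<tau>(1)] \<tau>(2) self_in_signed_orbit[of x w] by auto
  next
    fix \<sigma> assume "\<sigma> \<in> {\<sigma> \<in> signed_isos w S w' S'. \<sigma> x = y}"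
    then show "(\<lambda>i. if i \<in> ?O then \<tau> i else if i \<in> ?O then i else \<sigma> i) = \<sigma>"
      using eq by fastforce
  next
    fix \<rho> assume "\<rho> \<in> signed_isos w (S - ?O) w' (S' - signed_orbit w' y)"
    then show "(\<lambda>i. if i \<in> ?O then i else if i \<in> ?O then \<tau> i else \<rho> i) = \<rho>"
      by (auto simp: signed_isos_def fun_eq_iff)
  qed
  then show ?thesis by (rule bij_betw_same_card)
qed

text \<open>Induction on the number of points, sorting the isomorphisms by the image of one point
  \<open>x\<close>. The admissible images are the points of \<open>S'\<close> with the type of
  \<open>x\<close>, and each choice leaves the isomorphisms of the two complements;
  \<open>centralizer_size\<close> obeys the same recursion.\<close>

lemma card_signed_isos:
  assumes "signed_perm w" "signed_invariant w S" "signed_perm w'" "signed_invariant w' S'"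
    and "point_types w S = point_types w' S'"
  shows "card (signed_isos w S w' S') = centralizer_size (point_types w S)"
  using assms(2,4,5)
proof (induction "card S" arbitrary: S S' rule: less_induct)
  case less
  note inv = less.prems(1,2)
  have "card S' = card S"
  proof -
    have "card {x \<in> S. 0 < x} = card {x \<in> S'. 0 < x}"
      using arg_cong[OF less.prems(3), of size] by (simp add: point_types_def)
    then show ?thesis
      using inv card_symmetric[of S] card_symmetric[of S'] by (auto simp: signed_invariant_def)
  qed
  have fin: "finite S" "finite S'" using inv by (auto simp: signed_invariant_def)
  show ?case
  proof (cases "S = {}")
    case True
    then have "S' = {}" using \<open>card S' = card S\<close> fin by simp
    then have "signed_isos w S w' S' = {id}"
      using True by (auto simp: signed_isos_def bij_betw_def)
    then show ?thesis using True by (simp add: point_types_def)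
  next
    case False
    then obtain x where x: "x \<in> S" by auto
    let ?M = "point_types w (S - signed_orbit w x)"
    define v where "v = point_type w x"
    let ?Y = "{y \<in> S'. point_type w' y = v}"
    have v: "0 < fst v" "cyc_len w x = fst v"
      using cyc_len_pos[OF assms(1)] by (auto simp: v_def point_type_def)
    have M: "point_types w S = ?M + replicate_mset (fst v) v"
      using point_types_Diff[OF assms(1) inv(1) x] v(2) by (simp add: v_def)
    have smaller: "card (S - signed_orbit w x) < card S"
      using x self_in_signed_orbit[of x w] fin by (intro psubset_card_mono) auto
    have part: "card {\<sigma> \<in> signed_isos w S w' S'. \<sigma> x = y} = centralizer_size ?M" if y: "y \<in> ?Y" for y
    proof -
      have "cyc_len w' y = fst v" using y by (auto simp: point_type_def)
      then have "point_types w' S' = point_types w' (S' - signed_orbit w' y) + replicate_mset (fst v) v"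
        using point_types_Diff[OF assms(3) inv(2), of y] y by simp
      then have "?M = point_types w' (S' - signed_orbit w' y)"
        using M less.prems(3) by simp
      then show ?thesis
        using card_signed_isos_point[OF assms(1) inv(1) assms(3) inv(2) x, of y] y v_def
          less.hyps[OF smaller] signed_invariant_Diff[OF assms(1) inv(1)]
          signed_invariant_Diff[OF assms(3) inv(2)] by simp
    qed
    have "signed_isos w S w' S' = (\<Union>y\<in>?Y. {\<sigma> \<in> signed_isos w S w' S'. \<sigma> x = y})"
      using signed_isos_point_type[OF assms(1) inv(1) assms(3) inv(2) _ x] x
      by (auto simp: v_def signed_isos_def bij_betw_def)
    moreover have "card (\<Union>y\<in>?Y. {\<sigma> \<in> signed_isos w S w' S'. \<sigma> x = y}) =
        (\<Sum>y\<in>?Y. card {\<sigma> \<in> signed_isos w S w' S'. \<sigma> x = y})"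
    proof (rule card_UN_disjoint)
      have pos: "0 < centralizer_size ?M"
        by (intro centralizer_size_pos valid_point_types signed_invariant_Diff assms inv)
      \<comment> \<open>An infinite set has \<open>card\<close> 0, so positive cardinality gives
        finiteness.\<close>
      show "\<forall>y\<in>?Y. finite {\<sigma> \<in> signed_isos w S w' S'. \<sigma> x = y}"
        using part pos by (metis (mono_tags, lifting) card_gt_0_iff)
    qed (use fin in auto)
    moreover have "\<dots> = card ?Y * centralizer_size ?M"
      using part by simp
    moreover have "card ?Y = 2 * (count ?M v + fst v)"
      using count_point_types[OF assms(3) inv(2), of v] M less.prems(3) by simp
    moreover have "centralizer_size (point_types w S) = 2 * (count ?M v + fst v) * centralizer_size ?M"
      unfolding M by (intro centralizer_size_add v valid_types_dvd valid_point_types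
          signed_invariant_Diff assms inv)
    ultimately show ?thesis by simp
  qed
qed

section \<open>The weighted sum over cycle types\<close>

text \<open>The length in an occurring type divides its positive multiplicity and is thus at most n,
  which leaves finitely many types.\<close>

lemma finite_valid_types: "finite {M. valid_types M \<and> size M = n}"
proof -
  have "set_mset M \<subseteq> {..n} \<times> {1, -1}" if M: "valid_types M" "size M = n" for M
  proof
    fix v assume v: "v \<in># M"
    then have "fst v \<le> count M v"
      using M(1) by (auto simp: valid_types_def intro!: dvd_imp_le)
    also have "\<dots> \<le> n" using M(2) count_le_size[of M v] by simp
    finally show "v \<in> {..n} \<times> {1, -1}"
      using M(1) v by (cases v) (auto simp: valid_types_def)
  qed
  then have "{M. valid_types M \<and> size M = n} \<subseteq> {M. set_mset M \<subseteq> {..n} \<times> {1, -1} \<and> size M = n}"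
    by blast
  then show ?thesis
    by (rule finite_subset)
      (use finite_multisets_of_size[of "{..n} \<times> {1, -1}" n] in \<open>simp add: multisets_of_size_def\<close>)
qed

text \<open>The map \<phi> stays arbitrary because two instances are used: the action of k-th powers
  on types, and the constant map to \<open>()\<close>, whose fibers collect all valid multisets of
  one size.\<close>

definition fiber :: "(nat \<times> int \<Rightarrow> 'v) \<Rightarrow> 'v multiset \<Rightarrow> (nat \<times> int) multiset set"
  where "fiber \<phi> N = {M. valid_types M \<and> image_mset \<phi> M = N}"

definition fiber_weight :: "(nat \<times> int \<Rightarrow> 'v) \<Rightarrow> 'v multiset \<Rightarrow> 'a :: field_char_0"
  where "fiber_weight \<phi> N = (\<Sum>M\<in>fiber \<phi> N. 1 / of_nat (centralizer_size M))"

definition cycle_types_over :: "(nat \<times> int \<Rightarrow> 'v) \<Rightarrow> 'v multiset \<Rightarrow> (nat \<times> int) set"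
  where "cycle_types_over \<phi> A =
    {v. 0 < fst v \<and> snd v \<in> {1, -1} \<and> replicate_mset (fst v) (\<phi> v) = A}"

lemma finite_fiber: "finite (fiber \<phi> N)"
  by (rule finite_subset[OF _ finite_valid_types[of "size N"]]) (auto simp: fiber_def)

lemma finite_cycle_types_over: "finite (cycle_types_over \<phi> A)"
proof (rule finite_subset)
  show "cycle_types_over \<phi> A \<subseteq> {size A} \<times> {1, -1}"
    by (auto simp: cycle_types_over_def)
qed simp

lemma fiber_weight_empty: "fiber_weight \<phi> {#} = 1"
proof -
  have "fiber \<phi> {#} = {{#}}" by (auto simp: fiber_def valid_types_def)
  then show ?thesis by (simp add: fiber_weight_def)
qed

text \<open>Removing a cycle of type \<open>v\<close> divides the centralizer order by \<open>2\<close> times the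
  multiplicity of \<open>v\<close>; summing over \<open>v\<close> therefore gives the degree derivation of the series.\<close>

lemma fiber_weight_rec:
  "of_nat (size N) * fiber_weight \<phi> N =
    (\<Sum>A | A \<subseteq># N. of_nat (card (cycle_types_over \<phi> A)) / 2 * fiber_weight \<phi> (N - A) :: 'a :: field_char_0)"
proof -
  let ?r = "\<lambda>v :: nat \<times> int. replicate_mset (fst v) v"
  let ?z = "\<lambda>M. 1 / of_nat (centralizer_size M) :: 'a"
  have rem: "of_nat (count M v) * ?z M = ?z (M - ?r v) / 2" if "valid_types M" "v \<in># M" for M v
  proof -
    note d = valid_types_diff[OF that]
    let ?M = "M - ?r v"
    have "0 < fst v" using that by (auto simp: valid_types_def)
    then have "centralizer_size (?M + ?r v) = 2 * count (?M + ?r v) v * centralizer_size ?M"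
      using centralizer_size_add[of v ?M] valid_types_dvd[OF d(2), of v] by simp
    then have "centralizer_size M = 2 * count M v * centralizer_size ?M"
      unfolding subset_mset.diff_add[OF d(1)] .
    moreover have "centralizer_size M > 0" "centralizer_size ?M > 0"
      using that d(2) centralizer_size_pos by auto
    ultimately show ?thesis by (simp add: field_simps)
  qed
  have "of_nat (size N) * fiber_weight \<phi> N = (\<Sum>M\<in>fiber \<phi> N. of_nat (size M) * ?z M)"
    unfolding fiber_weight_def sum_distrib_left by (rule sum.cong) (auto simp: fiber_def)
  \<comment> \<open>The size is the sum of the multiplicities, and \<open>rem\<close> applies to
    each of them.\<close>
  also have "\<dots> = (\<Sum>M\<in>fiber \<phi> N. \<Sum>v\<in>set_mset M. ?z (M - ?r v) / 2)"
  proof (rule sum.cong[OF refl])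
    fix M assume "M \<in> fiber \<phi> N"
    then have "valid_types M" by (simp add: fiber_def)
    then show "of_nat (size M) * ?z M = (\<Sum>v\<in>set_mset M. ?z (M - ?r v) / 2)"
      unfolding size_multiset_overloaded_eq of_nat_sum sum_distrib_right
      by (intro sum.cong refl rem)
  qed
  also have "\<dots> = (\<Sum>(M, v)\<in>(SIGMA M:fiber \<phi> N. set_mset M). ?z (M - ?r v) / 2)"
    by (rule sum.Sigma) (auto simp: finite_fiber)
  \<comment> \<open>A multiset with a marked type v corresponds to the image A of one cycle of type
    v, the type v itself, and what remains after removing that cycle.\<close>
  also have "\<dots> = (\<Sum>(A, v, M)\<in>(SIGMA A:{A. A \<subseteq># N}. cycle_types_over \<phi> A \<times> fiber \<phi> (N - A)). ?z M / 2)"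
  proof (rule sum.reindex_bij_witness[where i = "\<lambda>(A, v, M). (M + ?r v, v)" and
        j = "\<lambda>(M, v). (replicate_mset (fst v) (\<phi> v), v, M - ?r v)"])
    fix p assume "p \<in> (SIGMA M:fiber \<phi> N. set_mset M)"
    then obtain M v where p: "p = (M, v)" "valid_types M" "image_mset \<phi> M = N" "v \<in># M"
      by (auto simp: fiber_def)
    note d = valid_types_diff[OF p(2,4)]
    have N: "N = image_mset \<phi> (M - ?r v) + replicate_mset (fst v) (\<phi> v)"
      unfolding p(3)[symmetric] using d(1)
      by (metis image_mset_union image_replicate_mset subset_mset.diff_add)
    show "(case (case p of (M, v) \<Rightarrow> (replicate_mset (fst v) (\<phi> v), v, M - ?r v)) of
        (A, v, M) \<Rightarrow> (M + ?r v, v)) = p"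
      using d(1) p(1) by simp
    show "(case p of (M, v) \<Rightarrow> (replicate_mset (fst v) (\<phi> v), v, M - ?r v)) \<in>
        (SIGMA A:{A. A \<subseteq># N}. cycle_types_over \<phi> A \<times> fiber \<phi> (N - A))"
      using p(1,2,4) d(2) N by (auto simp: cycle_types_over_def fiber_def valid_types_def)
  next
    fix q assume "q \<in> (SIGMA A:{A. A \<subseteq># N}. cycle_types_over \<phi> A \<times> fiber \<phi> (N - A))"
    then obtain A v M where q: "q = (A, v, M)" "A \<subseteq># N" "0 < fst v" "snd v \<in> {1, -1}"
        "A = replicate_mset (fst v) (\<phi> v)" "valid_types M" "image_mset \<phi> M = N - A"
      by (auto simp: cycle_types_over_def fiber_def)
    show "(case (case q of (A, v, M) \<Rightarrow> (M + ?r v, v)) of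
        (M, v) \<Rightarrow> (replicate_mset (fst v) (\<phi> v), v, M - ?r v)) = q"
      using q by simp
    have "image_mset \<phi> (M + ?r v) = N"
      using q(2,5,7) by simp
    then show "(case q of (A, v, M) \<Rightarrow> (M + ?r v, v)) \<in> (SIGMA M:fiber \<phi> N. set_mset M)"
      using q(1,3) valid_types_add[OF q(6,3,4)] by (auto simp: fiber_def)
  qed auto
  also have "\<dots> = (\<Sum>A | A \<subseteq># N. \<Sum>(v, M)\<in>cycle_types_over \<phi> A \<times> fiber \<phi> (N - A). ?z M / 2)"
    by (rule sum.Sigma[symmetric]) (auto simp: finite_submultisets finite_fiber finite_cycle_types_over)
  also have "\<dots> = (\<Sum>A | A \<subseteq># N. of_nat (card (cycle_types_over \<phi> A)) / 2 * fiber_weight \<phi> (N - A))"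
  proof (rule sum.cong[OF refl])
    fix A
    have "(\<Sum>M\<in>fiber \<phi> (N - A). ?z M / 2) = fiber_weight \<phi> (N - A) / 2"
      unfolding fiber_weight_def sum_divide_distrib ..
    then show "(\<Sum>(v, M)\<in>cycle_types_over \<phi> A \<times> fiber \<phi> (N - A). ?z M / 2) =
        of_nat (card (cycle_types_over \<phi> A)) / 2 * fiber_weight \<phi> (N - A)"
      unfolding sum.cartesian_product[symmetric] by simp
  qed
  finally show ?thesis .
qed

lemma submultisets_replicate_mset:
  "{A. A \<subseteq># replicate_mset n x} = (\<lambda>i. replicate_mset i x) ` {..n}"
proof (intro equalityI subsetI)
  fix A assume "A \<in> {A. A \<subseteq># replicate_mset n x}"
  then show "A \<in> (\<lambda>i. replicate_mset i x) ` {..n}"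
    using msubseteq_replicate_msetE[of A n x] by blast
qed (auto simp: subseteq_mset_def)

text \<open>Each positive length has two types, which cancels the factor 1/2; the recursion becomes
  n w(n) = w(0) + ... + w(n-1), whose solution with w(0) = 1 is constant. The total is needed to see
  that every valid multiset is realised by a group element.\<close>

lemma sum_valid_types: "(\<Sum>M | valid_types M \<and> size M = n. 1 / real (centralizer_size M)) = 1"
proof -
  let ?w = "\<lambda>n. fiber_weight (\<lambda>_. ()) (replicate_mset n ()) :: real"
  have "?w n = 1"
  proof (induction n rule: less_induct)
    case (less n)
    show ?case
    proof (cases "n = 0")
      case True
      then show ?thesis by (simp add: fiber_weight_empty)
    next
      case False
      have inj: "inj_on (\<lambda>i. replicate_mset i ()) {..n}"
        by (rule inj_onI) (drule arg_cong[of _ _ size], simp)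
      have card: "card (cycle_types_over (\<lambda>_. ()) (replicate_mset i ())) = (if i = 0 then 0 else 2)" for i
      proof -
        have "replicate_mset l () = replicate_mset i () \<longleftrightarrow> l = i" for l
          by (rule iffI) (drule arg_cong[of _ _ size], simp_all)
        then have "cycle_types_over (\<lambda>_. ()) (replicate_mset i ()) = {v. 0 < fst v \<and> snd v \<in> {1, -1} \<and> fst v = i}"
          unfolding cycle_types_over_def by metis
        also have "\<dots> = (if i = 0 then {} else {i} \<times> {1, -1})" by auto
        finally have "cycle_types_over (\<lambda>_. ()) (replicate_mset i ()) = (if i = 0 then {} else {i} \<times> {1, -1})" .
        then show ?thesis by simp
      qed
      have "real n * ?w n = (\<Sum>i\<le>n. real (card (cycle_types_over (\<lambda>_. ()) (replicate_mset i ()))) / 2 *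
          fiber_weight (\<lambda>_. ()) (replicate_mset n () - replicate_mset i ()))"
        using fiber_weight_rec[of "replicate_mset n ()" "\<lambda>_. ()", where 'a = real]
        unfolding submultisets_replicate_mset sum.reindex[OF inj] size_replicate_mset comp_apply .
      also have "\<dots> = (\<Sum>i\<in>{1..n}. 1)"
      proof (rule sum.mono_neutral_cong_right)
        fix i assume i: "i \<in> {1..n}"
        have diff: "replicate_mset n () - replicate_mset i () = replicate_mset (n - i) ()"
          by (rule multiset_eqI) simp
        have "?w (n - i) = 1" using i by (intro less.IH) auto
        then show "real (card (cycle_types_over (\<lambda>_. ()) (replicate_mset i ()))) / 2 *
            fiber_weight (\<lambda>_. ()) (replicate_mset n () - replicate_mset i ()) = 1"
          unfolding diff card using i by simp
      qed (auto simp: card)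
      finally show ?thesis using False by simp
    qed
  qed
  moreover have "fiber (\<lambda>_. ()) (replicate_mset n ()) = {M. valid_types M \<and> size M = n}"
  proof -
    have "image_mset (\<lambda>_. ()) M = replicate_mset n () \<longleftrightarrow> size M = n" for M :: "(nat \<times> int) multiset"
      unfolding image_mset_const_eq by (rule iffI) (drule arg_cong[of _ _ size], simp_all)
    then show ?thesis unfolding fiber_def by blast
  qed
  ultimately show ?thesis unfolding fiber_weight_def by metis
qed

section \<open>The exponential series and the degree derivation\<close>

text \<open>Degrees add under multiplication of monomials, so multiplying each coefficient by its
  degree is a derivation; the power rule follows.\<close>

lemma degree_derivation_power:
  fixes F :: "('v, 'a :: comm_ring_1) mfps"
  defines "D \<equiv> \<lambda>G :: ('v, 'a) mfps. Abs_mfps (\<lambda>M. of_nat (size M) * mfps_nth G M)"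
  shows "D (F ^ Suc m) = of_nat (Suc m) * (F ^ m * D F)"
proof -
  have D_mult: "D (G * H) = D G * H + G * D H" for G H
  proof (rule mfps_eqI)
    fix M
    have "of_nat (size M) * (mfps_nth G A * mfps_nth H (M - A)) =
        of_nat (size A) * mfps_nth G A * mfps_nth H (M - A) +
        mfps_nth G A * (of_nat (size (M - A)) * mfps_nth H (M - A))" if "A \<subseteq># M" for A
    proof -
      have "of_nat (size M) = (of_nat (size A) + of_nat (size (M - A)) :: 'a)"
        using size_mset_mono[OF that] by (simp add: size_Diff_submset[OF that] of_nat_diff)
      then show ?thesis by (simp add: algebra_simps)
    qed
    then show "mfps_nth (D (G * H)) M = mfps_nth (D G * H + G * D H) M"
      by (simp add: D_def mfps_nth_mult sum_distrib_left sum.distrib[symmetric])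
  qed
  show ?thesis
  proof (induction m)
    case 0
    then show ?case by simp
  next
    case (Suc m)
    have "D (F ^ Suc (Suc m)) = D F * F ^ Suc m + F * D (F ^ Suc m)"
      by (simp only: power_Suc[of F "Suc m"] D_mult)
    then show ?case
      unfolding Suc by (simp add: algebra_simps)
  qed
qed

lemma mfps_nth_of_nat_mult: "mfps_nth (of_nat n * F) M = of_nat n * mfps_nth F M"
  by (induction n) (simp_all add: algebra_simps)

text \<open>Powers beyond the degree of \<open>M\<close> do not contribute. The free bound
  \<open>K\<close> allows coefficients at different monomials to be summed over one common
  range.\<close>

lemma mfps_nth_exp:
  fixes F :: "('v, 'a :: field_char_0) mfps"
  assumes "mfps_nth F {#} = 0" "size M \<le> K"
  shows "mfps_nth (mfps_exp F) M = (\<Sum>m\<le>K. mfps_nth (F ^ m) M / fact m)"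
proof -
  have "mfps_nth (mfps_exp F) M = (\<Sum>m | mfps_nth (F ^ m) M \<noteq> 0. mfps_nth (F ^ m) M / fact m)"
    by (simp add: mfps_exp_def mfps_sum_def)
  also have "\<dots> = (\<Sum>m\<le>K. mfps_nth (F ^ m) M / fact m)"
  proof (rule sum.mono_neutral_left)
    show "{m. mfps_nth (F ^ m) M \<noteq> 0} \<subseteq> {..K}"
    proof
      fix m assume "m \<in> {m. mfps_nth (F ^ m) M \<noteq> 0}"
      then have "\<not> size M < m" using mfps_nth_power_eq_0[OF assms(1), of M m] by auto
      then show "m \<in> {..K}" using assms(2) by simp
    qed
  qed auto
  finally show ?thesis .
qed

lemma mfps_exp_rec:
  fixes F :: "('v, 'a :: field_char_0) mfps"
  assumes "mfps_nth F {#} = 0"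
  shows "of_nat (size M) * mfps_nth (mfps_exp F) M =
    (\<Sum>A | A \<subseteq># M. of_nat (size A) * mfps_nth F A * mfps_nth (mfps_exp F) (M - A))"
proof -
  define D where "D = (\<lambda>G :: ('v, 'a) mfps. Abs_mfps (\<lambda>M. of_nat (size M) * mfps_nth G M))"
  \<comment> \<open>The cutoff is one more than the degree, so that dropping the term m = 0, which
    the derivation kills, and shifting the index leaves the range up to
    \<open>size M\<close>.\<close>
  have "of_nat (size M) * mfps_nth (mfps_exp F) M = (\<Sum>m\<le>Suc (size M). mfps_nth (D (F ^ m)) M / fact m)"
    unfolding mfps_nth_exp[OF assms le_SucI[OF order_refl]] sum_distrib_left by (simp add: D_def)
  also have "\<dots> = (\<Sum>m\<le>size M. mfps_nth (D (F ^ Suc m)) M / fact (Suc m))"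
    by (subst sum.atMost_Suc_shift) (simp add: D_def mfps_nth_one)
  also have "\<dots> = (\<Sum>m\<le>size M. mfps_nth (D F * F ^ m) M / fact m)"
  proof (rule sum.cong[OF refl])
    fix m
    have "mfps_nth (D (F ^ Suc m)) M = of_nat (Suc m) * mfps_nth (D F * F ^ m) M"
      unfolding D_def degree_derivation_power mfps_nth_of_nat_mult by (simp only: mult.commute)
    then show "mfps_nth (D (F ^ Suc m)) M / fact (Suc m) = mfps_nth (D F * F ^ m) M / fact m"
      by (simp add: field_simps del: of_nat_Suc)
  qed
  also have "\<dots> = (\<Sum>A | A \<subseteq># M. \<Sum>m\<le>size M. mfps_nth (D F) A * mfps_nth (F ^ m) (M - A) / fact m)"
    unfolding mfps_nth_mult sum_divide_distrib by (rule sum.swap)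
  also have "\<dots> = (\<Sum>A | A \<subseteq># M. of_nat (size A) * mfps_nth F A * mfps_nth (mfps_exp F) (M - A))"
  proof (rule sum.cong[OF refl])
    fix A assume "A \<in> {A. A \<subseteq># M}"
    then have "size (M - A) \<le> size M" by (intro size_mset_mono) auto
    then show "(\<Sum>m\<le>size M. mfps_nth (D F) A * mfps_nth (F ^ m) (M - A) / fact m) =
        of_nat (size A) * mfps_nth F A * mfps_nth (mfps_exp F) (M - A)"
      using mfps_nth_exp[OF assms] by (simp add: D_def sum_distrib_left)
  qed
  finally show ?thesis .
qed

text \<open>The summand for the empty \<open>A\<close> vanishes, so the recursion determines a
  coefficient of positive degree from those of smaller degree, starting from the constant term
  1.\<close>

lemma mfps_exp_eqI:
  fixes F G :: "('v, 'a :: field_char_0) mfps"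
  assumes "mfps_nth F {#} = 0" "mfps_nth G {#} = 1"
    and "\<And>M. of_nat (size M) * mfps_nth G M =
      (\<Sum>A | A \<subseteq># M. of_nat (size A) * mfps_nth F A * mfps_nth G (M - A))"
  shows "G = mfps_exp F"
proof (rule mfps_eqI)
  fix M
  show "mfps_nth G M = mfps_nth (mfps_exp F) M"
  proof (induction "size M" arbitrary: M rule: less_induct)
    case less
    show ?case
    proof (cases "M = {#}")
      case True
      have "mfps_nth (mfps_exp F) {#} = 1"
        using mfps_nth_exp[OF assms(1), of "{#}" 0] by (simp add: mfps_nth_one)
      with True assms(2) show ?thesis by simp
    next
      case False
      have "of_nat (size M) * mfps_nth G M = of_nat (size M) * mfps_nth (mfps_exp F) M"
        unfolding assms(3) mfps_exp_rec[OF assms(1)]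
      proof (rule sum.cong[OF refl])
        fix A assume A: "A \<in> {A. A \<subseteq># M}"
        show "of_nat (size A) * mfps_nth F A * mfps_nth G (M - A) =
            of_nat (size A) * mfps_nth F A * mfps_nth (mfps_exp F) (M - A)"
        proof (cases "A = {#}")
          case True
          then show ?thesis by simp
        next
          case False
          then have "0 < size A" by (simp add: nonempty_has_size)
          moreover have "size A \<le> size M" using A by (simp add: size_mset_mono)
          ultimately have "size (M - A) < size M"
            using A by (simp add: size_Diff_submset)
          then show ?thesis using less by simp
        qed
      qed
      with False show ?thesis by simp
    qed
  qed
qed

section \<open>Cycle types in hyperoctahedral groups\<close>

definition types :: "nat \<Rightarrow> (int \<Rightarrow> int) \<Rightarrow> (nat \<times> int) multiset"
  where "types n g = point_types g (signed_points n)"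

lemma finite_signed_points: "finite (signed_points n)"
  by (rule finite_subset[of _ "{- int n..int n}"]) (auto simp: signed_points_def)

lemma signed_perm_hyperoctahedral: "g \<in> carrier (hyperoctahedral n) \<Longrightarrow> signed_perm g"
proof -
  assume "g \<in> carrier (hyperoctahedral n)"
  then have p: "g permutes signed_points n" and odd: "\<And>i. i \<in> signed_points n \<Longrightarrow> g (- i) = - g i"
    by (auto simp: hyperoctahedral_def)
  have "g (- i) = - g i" for i
  proof (cases "i \<in> signed_points n")
    case False
    then have "- i \<notin> signed_points n" by (auto simp: signed_points_def)
    then show ?thesis using False p by (simp add: permutes_not_in)
  qed (rule odd)
  then show ?thesis
    using p finite_signed_points by (auto simp: signed_perm_def permutation_permutes)
qed

lemma signed_invariant_hyperoctahedral:
  "g \<in> carrier (hyperoctahedral n) \<Longrightarrow> signed_invariant g (signed_points n)"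
  by (auto simp: hyperoctahedral_def signed_invariant_def finite_signed_points permutes_in_image)
    (auto simp: signed_points_def)

lemmas hyperoctahedral_signed = signed_perm_hyperoctahedral signed_invariant_hyperoctahedral

text \<open>Isomorphisms are the conjugating elements: all maps involved fix the integers outside
  \<open>signed_points n\<close>, so the commutation relation holds there automatically.\<close>

lemma signed_isos_hyperoctahedral:
  assumes "g \<in> carrier (hyperoctahedral n)" "g' \<in> carrier (hyperoctahedral n)"
  shows "signed_isos g (signed_points n) g' (signed_points n) =
    {\<sigma> \<in> carrier (hyperoctahedral n). \<sigma> \<circ> g = g' \<circ> \<sigma>}"
proof -
  have p: "g permutes signed_points n" "g' permutes signed_points n"
    using assms by (auto simp: hyperoctahedral_def)
  have "\<sigma> \<circ> g = g' \<circ> \<sigma> \<longleftrightarrow> (\<forall>i\<in>signed_points n. \<sigma> (g i) = g' (\<sigma> i))"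
    if "\<sigma> permutes signed_points n" for \<sigma>
    using that p by (fastforce simp: fun_eq_iff permutes_not_in)
  moreover have "\<sigma> permutes signed_points n \<longleftrightarrow>
      bij_betw \<sigma> (signed_points n) (signed_points n) \<and> (\<forall>i. i \<notin> signed_points n \<longrightarrow> \<sigma> i = i)" for \<sigma>
    by (auto intro: bij_imp_permutes permutes_imp_bij simp: permutes_not_in)
  ultimately show ?thesis
    by (auto simp: signed_isos_def hyperoctahedral_def)
qed

lemma valid_types_types: "g \<in> carrier (hyperoctahedral n) \<Longrightarrow> valid_types (types n g)"
  unfolding types_def by (intro valid_point_types hyperoctahedral_signed)

lemma size_types: "size (types n g) = n"
proof -
  have "{x \<in> signed_points n. 0 < x} = {1..int n}"
    by (auto simp: signed_points_def)
  then show ?thesis by (simp add: types_def point_types_def)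
qed

lemma finite_hyperoctahedral: "finite (carrier (hyperoctahedral n))"
  by (rule finite_subset[OF _ finite_permutations[OF finite_signed_points[of n]]])
    (auto simp: hyperoctahedral_def)

lemma pow_hyperoctahedral: "h [^]\<^bsub>hyperoctahedral n\<^esub> k = h ^^ k"
  for k :: nat
  by (induction k) (simp_all add: hyperoctahedral_def nat_pow_def id_def funpow_Suc_right del: funpow.simps(2))

lemma funpow_in_hyperoctahedral:
  "h \<in> carrier (hyperoctahedral n) \<Longrightarrow> h ^^ k \<in> carrier (hyperoctahedral n)"
  using monoid.nat_pow_closed[OF group.is_monoid[OF group_hyperoctahedral], of h n k]
  by (simp add: pow_hyperoctahedral)

definition pow_type :: "nat \<Rightarrow> nat \<times> int \<Rightarrow> nat \<times> int"
  where "pow_type k v = (fst v div gcd (fst v) k, snd v ^ (k div gcd (fst v) k))"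

lemma types_funpow:
  assumes "h \<in> carrier (hyperoctahedral n)" "k > 0"
  shows "types n (h ^^ k) = image_mset (pow_type k) (types n h)"
proof -
  have "point_type (h ^^ k) x = pow_type k (point_type h x)" if "x > 0" for x
    using point_type_of_funpow[OF signed_perm_hyperoctahedral[OF assms(1)] _ assms(2), of x] that
    by (simp add: pow_type_def)
  then show ?thesis
    by (auto simp: types_def point_types_def image_mset.compositionality finite_signed_points
        intro!: image_mset_cong)
qed

section \<open>Conjugacy and centralizers\<close>

lemma card_centralizing:
  assumes "g \<in> carrier (hyperoctahedral n)" "g' \<in> carrier (hyperoctahedral n)" "types n g = types n g'"
  shows "card {\<sigma> \<in> carrier (hyperoctahedral n). \<sigma> \<circ> g = g' \<circ> \<sigma>} = centralizer_size (types n g)"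
  using card_signed_isos[OF hyperoctahedral_signed[OF assms(1)] hyperoctahedral_signed[OF assms(2)]] assms(3)
  unfolding signed_isos_hyperoctahedral[OF assms(1,2)] types_def by blast

text \<open>Existence by counting: the number of conjugating elements is positive.\<close>

lemma conjugating_exists:
  assumes "g \<in> carrier (hyperoctahedral n)" "g' \<in> carrier (hyperoctahedral n)" "types n g = types n g'"
  obtains \<sigma> where "\<sigma> \<in> carrier (hyperoctahedral n)" "\<sigma> \<circ> g = g' \<circ> \<sigma>"
proof -
  have "card {\<sigma> \<in> carrier (hyperoctahedral n). \<sigma> \<circ> g = g' \<circ> \<sigma>} > 0"
    unfolding card_centralizing[OF assms] by (intro centralizer_size_pos valid_types_types assms)
  then show thesis using that by (fastforce simp: card_gt_0_iff)
qed

lemma card_centralizer: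
  "g \<in> carrier (hyperoctahedral n) \<Longrightarrow>
    card (centralizer (hyperoctahedral n) g) = centralizer_size (types n g)"
  using card_centralizing[of g n g] by (simp add: centralizer_def hyperoctahedral_def)

lemma (in group) nat_pow_conj:
  assumes "x \<in> carrier G" "h \<in> carrier G"
  shows "(x \<otimes> h \<otimes> inv x) [^] (k :: nat) = x \<otimes> (h [^] k) \<otimes> inv x"
proof (induction k)
  case (Suc k)
  have "x \<otimes> (h [^] k) \<otimes> inv x \<otimes> (x \<otimes> h \<otimes> inv x) = x \<otimes> (h [^] k) \<otimes> (inv x \<otimes> x) \<otimes> h \<otimes> inv x"
    using assms by (simp only: m_assoc inv_closed m_closed nat_pow_closed)
  with Suc assms show ?case by (simp add: m_assoc)
qed (use assms in simp)

text \<open>Conjugation by \<open>x\<close> maps k-th roots of \<open>g\<close> bijectively to k-th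
  roots of \<open>g'\<close>.\<close>

lemma (in group) roots_conj:
  assumes "x \<in> carrier G" "g \<in> carrier G" "g' \<in> carrier G" "x \<otimes> g = g' \<otimes> x"
  shows "roots k G g = roots k G g'"
proof -
  have g': "x \<otimes> g \<otimes> inv x = g'" using assms by (simp add: m_assoc)
  have g: "inv x \<otimes> g' \<otimes> x = g" using assms by (simp add: m_assoc flip: assms(4)) (simp add: m_assoc[symmetric])
  have "bij_betw (\<lambda>h. x \<otimes> h \<otimes> inv x) {h \<in> carrier G. h [^] k = g} {h \<in> carrier G. h [^] k = g'}"
  proof (rule bij_betwI[where g = "\<lambda>h. inv x \<otimes> h \<otimes> x"])
    show "(\<lambda>h. x \<otimes> h \<otimes> inv x) \<in> {h \<in> carrier G. h [^] k = g} \<rightarrow> {h \<in> carrier G. h [^] k = g'}"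
      using assms(1) g' nat_pow_conj[OF assms(1)] by auto
    show "(\<lambda>h. inv x \<otimes> h \<otimes> x) \<in> {h \<in> carrier G. h [^] k = g'} \<rightarrow> {h \<in> carrier G. h [^] k = g}"
      using assms(1) g nat_pow_conj[of "inv x"] by auto
  next
    fix h assume "h \<in> {h \<in> carrier G. h [^] k = g}"
    then have h: "h \<in> carrier G" by simp
    have "inv x \<otimes> (x \<otimes> h \<otimes> inv x) \<otimes> x = (inv x \<otimes> x) \<otimes> h \<otimes> (inv x \<otimes> x)"
      using h assms(1) by (simp only: m_assoc inv_closed m_closed)
    then show "inv x \<otimes> (x \<otimes> h \<otimes> inv x) \<otimes> x = h" using h assms(1) by simp
  next
    fix h assume "h \<in> {h \<in> carrier G. h [^] k = g'}"
    then have h: "h \<in> carrier G" by simp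
    have "x \<otimes> (inv x \<otimes> h \<otimes> x) \<otimes> inv x = (x \<otimes> inv x) \<otimes> h \<otimes> (x \<otimes> inv x)"
      using h assms(1) by (simp only: m_assoc inv_closed m_closed)
    then show "x \<otimes> (inv x \<otimes> h \<otimes> x) \<otimes> inv x = h" using h assms(1) by simp
  qed
  then show ?thesis unfolding roots_def by (rule bij_betw_same_card)
qed

lemma roots_hyperoctahedral_cong:
  assumes "g \<in> carrier (hyperoctahedral n)" "g' \<in> carrier (hyperoctahedral n)" "types n g = types n g'"
  shows "roots k (hyperoctahedral n) g = roots k (hyperoctahedral n) g'"
proof -
  obtain \<sigma> where "\<sigma> \<in> carrier (hyperoctahedral n)" "\<sigma> \<circ> g = g' \<circ> \<sigma>"
    using conjugating_exists[OF assms] .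
  then show ?thesis
    by (intro group.roots_conj[OF group_hyperoctahedral _ assms(1,2)]) (auto simp: hyperoctahedral_def)
qed

section \<open>Signed cycles and point types\<close>

lemma orbit_Un_minus:
  assumes "signed_perm w"
  shows "orbit w x \<union> uminus ` orbit w x = signed_orbit w x"
proof -
  have "orbit w x = {(w ^^ i) x | i. True}"
    using assms by (intro orbit_altdef_permutation) (simp add: signed_perm_def)
  then show ?thesis
    by (auto simp: signed_orbit_def abs_eq_iff image_iff)
qed

text \<open>A cycle is its own negative iff some iterate of x is -x. Such an iterate makes a power
  of the sign equal to -1; conversely, sign -1 gives one after a single turn.\<close>

lemma orbit_eq_minus_iff:
  assumes "signed_perm w" "x \<noteq> 0"
  shows "orbit w x = uminus ` orbit w x \<longleftrightarrow> cyc_sign w x = -1"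
proof -
  have orb: "orbit w x = range (\<lambda>i. (w ^^ i) x)"
    using assms orbit_altdef_permutation[of w x] by (auto simp: signed_perm_def)
  show ?thesis
  proof
    assume "orbit w x = uminus ` orbit w x"
    moreover have "x \<in> orbit w x" unfolding orb by (rule range_eqI[of _ _ 0]) simp
    ultimately have "- x \<in> orbit w x" by force
    then obtain i where "(w ^^ i) x = -1 * x" by (auto simp: orb)
    then have "cyc_sign w x ^ (i div cyc_len w x) = -1"
      using funpow_eq_sign_iff[OF assms, of "-1" i] by simp
    then show "cyc_sign w x = -1"
      using cyc_sign_cases[of w x] by auto
  next
    assume s: "cyc_sign w x = -1"
    have "- (w ^^ i) x = (w ^^ (i + cyc_len w x)) x" for i
      using funpow_cyc_len[OF assms(1), of x] s by (simp add: funpow_add funpow_minus[OF assms(1)])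
    then have neg: "- y \<in> orbit w x" if "y \<in> orbit w x" for y
      using that unfolding orb by auto
    show "orbit w x = uminus ` orbit w x"
    proof (intro equalityI subsetI)
      fix y assume "y \<in> orbit w x"
      then show "y \<in> uminus ` orbit w x" using neg[of y] by force
    qed (use neg in auto)
  qed
qed

lemma signed_cycles_eq:
  assumes "w \<in> carrier (hyperoctahedral n)"
  shows "signed_cycles n w \<theta> = signed_orbit w ` {x \<in> signed_points n. cyc_sign w x = \<theta>}"
proof -
  let ?sgn = "\<lambda>c :: int set. if c = uminus ` c then -1 else 1 :: int"
  have sgn: "?sgn (orbit w x) = cyc_sign w x" if "x \<in> signed_points n" for x
  proof -
    have "x \<noteq> 0" using that by (simp add: signed_points_def)
    have "?sgn (orbit w x) = (if cyc_sign w x = -1 then -1 else 1)"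
      by (simp only: orbit_eq_minus_iff[OF signed_perm_hyperoctahedral[OF assms] \<open>x \<noteq> 0\<close>])
    then show ?thesis using cyc_sign_cases[of w x] by auto
  qed
  have "signed_cycles n w \<theta> =
      {orbit w x \<union> uminus ` orbit w x | x. x \<in> signed_points n \<and> \<theta> = ?sgn (orbit w x)}"
    unfolding signed_cycles_def by blast
  also have "\<dots> = {signed_orbit w x | x. x \<in> signed_points n \<and> \<theta> = cyc_sign w x}"
    unfolding orbit_Un_minus[OF signed_perm_hyperoctahedral[OF assms]]
    by (intro Collect_cong ex_cong1 conj_cong refl) (simp only: sgn)
  also have "\<dots> = signed_orbit w ` {x \<in> signed_points n. cyc_sign w x = \<theta>}"
    by blast
  finally show ?thesis .
qed

text \<open>The signed cycles of length j and class \<theta> are disjoint, have 2j elements each,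
  and together form the set of points of type (j, \<theta>).\<close>

lemma count_types:
  assumes "w \<in> carrier (hyperoctahedral n)"
  shows "count (types n w) (j, \<theta>) = j * count (cycle_lengths n w \<theta>) j"
proof -
  note sp = signed_perm_hyperoctahedral[OF assms] and inv = signed_invariant_hyperoctahedral[OF assms]
  let ?C = "{C \<in> signed_cycles n w \<theta>. card C div 2 = j}"
  have nz: "x \<noteq> 0" if "x \<in> signed_points n" for x using that by (simp add: signed_points_def)
  have C: "?C = signed_orbit w ` {x \<in> signed_points n. point_type w x = (j, \<theta>)}"
    using card_signed_orbit(1)[OF sp] nz
    unfolding signed_cycles_eq[OF assms] point_type_def by force
  have Un: "\<Union>?C = {x \<in> signed_points n. point_type w x = (j, \<theta>)}"
    unfolding C
  proof (intro equalityI subsetI)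
    fix y assume "y \<in> \<Union> (signed_orbit w ` {x \<in> signed_points n. point_type w x = (j, \<theta>)})"
    then obtain x where x: "x \<in> signed_points n" "point_type w x = (j, \<theta>)" "y \<in> signed_orbit w x" by auto
    then show "y \<in> {x \<in> signed_points n. point_type w x = (j, \<theta>)}"
      using signed_orbit_subset[OF inv x(1)] point_type_signed_orbit[OF sp nz[OF x(1)] x(3)] by auto
  qed (use self_in_signed_orbit in blast)
  have fin: "finite (signed_cycles n w \<theta>)"
    unfolding signed_cycles_eq[OF assms] by (simp add: finite_signed_points)
  have "card (\<Union>?C) = (\<Sum>A\<in>?C. card A)"
  proof (rule card_Union_disjoint)
    show "pairwise disjnt ?C"
    proof (rule pairwiseI)
      fix A B assume "A \<in> ?C" "B \<in> ?C" "A \<noteq> B"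
      then show "disjnt A B"
        unfolding C disjnt_def using signed_orbit_eq[OF sp] by blast
    qed
    show "finite A" if "A \<in> ?C" for A
      using that card_signed_orbit(2)[OF sp] nz unfolding C by auto
  qed
  also have "\<dots> = (\<Sum>A\<in>?C. 2 * j)"
    using card_signed_orbit(1)[OF sp] nz unfolding C by (intro sum.cong) (auto simp: point_type_def)
  also have "\<dots> = 2 * (j * count (cycle_lengths n w \<theta>) j)"
    using fin by (simp add: cycle_lengths_def count_image_mset_eq_card_vimage)
  finally show ?thesis
    using count_point_types[OF sp inv, of "(j, \<theta>)"] unfolding Un types_def by simp
qed

text \<open>The exponent multiset of \<open>cycle_monomial\<close>, written with the same double
  index.\<close>

definition types_of :: "bipartition \<Rightarrow> (nat \<times> int) multiset"
  where "types_of \<mu> = (\<Sum>\<theta>\<in>carrier Z2. \<Sum>j\<in>set_mset (part \<mu> \<theta>).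
    replicate_mset (j * count (part \<mu> \<theta>) j) (j, \<theta>))"

lemma carrier_Z2: "carrier Z2 = {1, -1}"
  by (simp add: Z2_def)

lemma count_types_of:
  "count (types_of \<mu>) (j, \<theta>) = (if \<theta> \<in> {1, -1} then j * count (part \<mu> \<theta>) j else 0)"
proof -
  have "(\<Sum>i\<in>set_mset (part \<mu> \<eta>). count (replicate_mset (i * count (part \<mu> \<eta>) i) (i, \<eta>)) (j, \<theta>)) =
      (if \<eta> = \<theta> then j * count (part \<mu> \<theta>) j else 0)" for \<eta>
  proof (cases "\<eta> = \<theta>")
    case True
    then have "(\<Sum>i\<in>set_mset (part \<mu> \<eta>). count (replicate_mset (i * count (part \<mu> \<eta>) i) (i, \<eta>)) (j, \<theta>)) =
        (\<Sum>i\<in>set_mset (part \<mu> \<theta>). if i = j then j * count (part \<mu> \<theta>) j else 0)"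
      by (intro sum.cong) auto
    also have "\<dots> = (if \<eta> = \<theta> then j * count (part \<mu> \<theta>) j else 0)"
      using True by (auto simp: sum.delta not_in_iff)
    finally show ?thesis .
  qed auto
  then show ?thesis by (auto simp: types_of_def count_sum carrier_Z2)
qed

lemma part_cycle_type: "\<theta> \<in> {1, -1} \<Longrightarrow> part (cycle_type n w) \<theta> = cycle_lengths n w \<theta>"
  by (auto simp: part_def cycle_type_def)

lemma types_of_cycle_type:
  assumes "w \<in> carrier (hyperoctahedral n)"
  shows "types_of (cycle_type n w) = types n w"
proof (rule multiset_eqI)
  fix v :: "nat \<times> int"
  obtain j \<theta> where v: "v = (j, \<theta>)" by (cases v)
  show "count (types_of (cycle_type n w)) v = count (types n w) v"
  proof (cases "\<theta> \<in> {1, -1}")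
    case True
    then show ?thesis
      unfolding v count_types_of count_types[OF assms] by (simp only: part_cycle_type if_True)
  next
    case False
    then have "v \<notin># types n w"
      using valid_types_types[OF assms] by (auto simp: v valid_types_def)
    then show ?thesis using False by (simp add: v count_types_of not_in_iff)
  qed
qed

text \<open>The multiplicity of a part j is the multiplicity of (j, \<theta>) divided by j. The part
  0 would be invisible, but bipartitions exclude it.\<close>

lemma inj_types_of: "inj_on types_of (bipartitions n)"
proof (rule inj_onI)
  fix \<mu> \<nu> assume *: "\<mu> \<in> bipartitions n" "\<nu> \<in> bipartitions n" "types_of \<mu> = types_of \<nu>"
  have zero: "0 \<notin># part \<mu> \<theta>" "0 \<notin># part \<nu> \<theta>" for \<theta>
    using *(1,2) by (auto simp: bipartitions_def part_def)
  have "part \<mu> \<theta> = part \<nu> \<theta>" if "\<theta> \<in> {1, -1}" for \<theta>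
  proof (rule multiset_eqI)
    fix j
    have "j * count (part \<mu> \<theta>) j = j * count (part \<nu> \<theta>) j"
      using arg_cong[OF *(3), of "\<lambda>M. count M (j, \<theta>)"] that by (simp only: count_types_of if_True)
    then show "count (part \<mu> \<theta>) j = count (part \<nu> \<theta>) j"
      using zero[of \<theta>] by (cases "j = 0") (auto simp: not_in_iff)
  qed
  from this[of 1] this[of "-1"] show "\<mu> = \<nu>"
    by (simp add: part_def prod_eq_iff)
qed

lemma size_types_of:
  "\<mu> \<in> bipartitions n \<Longrightarrow> size (types_of \<mu>) = n"
  by (simp add: types_of_def size_sum_multiset sum_mset_eq_sum_count[symmetric] carrier_Z2
      part_def bipartitions_def)

lemma valid_types_of:
  assumes "\<mu> \<in> bipartitions n"
  shows "valid_types (types_of \<mu>)"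
  unfolding valid_types_def
proof
  fix v assume v: "v \<in># types_of \<mu>"
  obtain j \<theta> where [simp]: "v = (j, \<theta>)" by (cases v)
  have "count (types_of \<mu>) (j, \<theta>) \<noteq> 0" using v by simp
  then show "0 < fst v \<and> snd v \<in> {1, -1} \<and> fst v dvd count (types_of \<mu>) v"
    by (auto simp: count_types_of split: if_splits)
qed

lemma cycle_type_in_bipartitions:
  assumes "w \<in> carrier (hyperoctahedral n)"
  shows "cycle_type n w \<in> bipartitions n"
proof -
  have zero: "0 \<notin># cycle_lengths n w \<theta>" for \<theta>
  proof -
    have "card C div 2 > 0" if "C \<in> signed_cycles n w \<theta>" for C
      using that card_signed_orbit(1)[OF signed_perm_hyperoctahedral[OF assms]]
        cyc_len_pos[OF signed_perm_hyperoctahedral[OF assms]]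
      by (auto simp: signed_cycles_eq[OF assms] signed_points_def)
    moreover have "finite (signed_cycles n w \<theta>)"
      unfolding signed_cycles_eq[OF assms] by (simp add: finite_signed_points)
    ultimately show ?thesis by (fastforce simp: cycle_lengths_def)
  qed
  moreover have "sum_mset (fst (cycle_type n w)) + sum_mset (snd (cycle_type n w)) = size (types_of (cycle_type n w))"
    by (simp add: types_of_def size_sum_multiset sum_mset_eq_sum_count[symmetric] carrier_Z2 part_def)
  ultimately show ?thesis
    unfolding types_of_cycle_type[OF assms] size_types
    by (auto simp: bipartitions_def cycle_type_def)
qed

text \<open>Elements of equal cycle type have equal \<open>types\<close>, so the description in
  \<open>class_value\<close> is met by \<open>f g\<close>; the element \<open>g\<close> itself
  forces uniqueness.\<close>

lemma class_value_eq:
  assumes "g \<in> carrier (hyperoctahedral n)"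
    and "\<And>g'. g' \<in> carrier (hyperoctahedral n) \<Longrightarrow> types n g' = types n g \<Longrightarrow> f g' = f g"
  shows "class_value n f (cycle_type n g) = f g"
  unfolding class_value_def
proof (rule the_equality)
  show "\<forall>g'\<in>carrier (hyperoctahedral n). cycle_type n g' = cycle_type n g \<longrightarrow> f g' = f g"
    using assms types_of_cycle_type by metis
qed (use assms(1) in blast)

section \<open>Coefficients of the two sides\<close>

lemma card_eq_sum_card_fibers:
  assumes "finite B" "finite T"
  shows "card {x \<in> B. f x \<in> T} = (\<Sum>t\<in>T. card {x \<in> B. f x = t})"
proof -
  have "{x \<in> B. f x \<in> T} = (\<Union>t\<in>T. {x \<in> B. f x = t})" by auto
  then show ?thesis using assms by (simp only:) (rule card_UN_disjoint, auto)
qed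

definition types_class :: "nat \<Rightarrow> (nat \<times> int) multiset \<Rightarrow> (int \<Rightarrow> int) set"
  where "types_class n M = {g \<in> carrier (hyperoctahedral n). types n g = M}"

lemma finite_types_class: "finite (types_class n M)"
  by (simp add: types_class_def finite_hyperoctahedral)

text \<open>Fixing \<open>g0\<close> in the class, every \<open>\<sigma>\<close> conjugates \<open>g0\<close> to exactly one \<open>g\<close> in the class.\<close>

lemma card_types_class:
  assumes "types_class n M \<noteq> {}"
  shows "card (carrier (hyperoctahedral n)) = card (types_class n M) * centralizer_size M"
proof -
  let ?B = "carrier (hyperoctahedral n)"
  obtain g0 where g0: "g0 \<in> ?B" "types n g0 = M" using assms by (auto simp: types_class_def)
  let ?conj = "\<lambda>\<sigma>. \<sigma> \<circ> g0 \<circ> inv_into UNIV \<sigma>"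
  interpret group "hyperoctahedral n" by (rule group_hyperoctahedral)
  have bij: "bij \<sigma>" if "\<sigma> \<in> ?B" for \<sigma>
    using that by (auto simp: hyperoctahedral_def permutes_bij)
  have conj_iff: "?conj \<sigma> = g \<longleftrightarrow> \<sigma> \<circ> g0 = g \<circ> \<sigma>" if "\<sigma> \<in> ?B" for \<sigma> g
  proof
    assume "?conj \<sigma> = g"
    then show "\<sigma> \<circ> g0 = g \<circ> \<sigma>"
      using bij[OF that] by (metis bij_is_inj comp_assoc comp_id inv_o_cancel)
  next
    assume "\<sigma> \<circ> g0 = g \<circ> \<sigma>"
    then show "?conj \<sigma> = g"
      using bij[OF that] by (auto simp: fun_eq_iff bij_is_surj surj_f_inv_f)
  qed
  have conj_in: "?conj \<sigma> \<in> types_class n M" if \<sigma>: "\<sigma> \<in> ?B" for \<sigma>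
  proof -
    define g where "g = \<sigma> \<otimes>\<^bsub>hyperoctahedral n\<^esub> g0 \<otimes>\<^bsub>hyperoctahedral n\<^esub> inv\<^bsub>hyperoctahedral n\<^esub> \<sigma>"
    have g: "g \<in> ?B" using \<sigma> g0 by (simp add: g_def)
    have "g \<otimes>\<^bsub>hyperoctahedral n\<^esub> \<sigma> = \<sigma> \<otimes>\<^bsub>hyperoctahedral n\<^esub> g0"
      using \<sigma> g0 by (simp add: g_def m_assoc)
    then have comm: "\<sigma> \<circ> g0 = g \<circ> \<sigma>" by (simp add: hyperoctahedral_def)
    then have "\<sigma> \<in> signed_isos g0 (signed_points n) g (signed_points n)"
      using signed_isos_hyperoctahedral[OF g0(1) g] \<sigma> by blast
    then have "types n g = types n g0"
      unfolding types_def
      by (intro signed_isos_point_types hyperoctahedral_signed[OF g0(1)] hyperoctahedral_signed[OF g])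
    moreover have "?conj \<sigma> = g" using conj_iff[OF \<sigma>] comm by blast
    ultimately show ?thesis
      unfolding types_class_def using g g0(2) by simp
  qed
  have "card ?B = card {\<sigma> \<in> ?B. ?conj \<sigma> \<in> types_class n M}"
    using conj_in by (intro arg_cong[of _ _ card]) auto
  also have "\<dots> = (\<Sum>g\<in>types_class n M. card {\<sigma> \<in> ?B. ?conj \<sigma> = g})"
    by (rule card_eq_sum_card_fibers[OF finite_hyperoctahedral finite_types_class])
  also have "\<dots> = (\<Sum>g\<in>types_class n M. centralizer_size M)"
  proof (rule sum.cong[OF refl])
    fix g assume "g \<in> types_class n M"
    then have g: "g \<in> ?B" "types n g0 = types n g" using g0(2) by (auto simp: types_class_def)
    have "{\<sigma> \<in> ?B. ?conj \<sigma> = g} = {\<sigma> \<in> ?B. \<sigma> \<circ> g0 = g \<circ> \<sigma>}"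
      using conj_iff by blast
    then show "card {\<sigma> \<in> ?B. ?conj \<sigma> = g} = centralizer_size M"
      using card_centralizing[OF g0(1) g] g0(2) by simp
  qed
  finally show ?thesis by simp
qed

text \<open>The classes that do occur already exhaust the total weight \<open>1\<close>, so every class occurs.\<close>

lemma types_surj:
  "types n ` carrier (hyperoctahedral n) = {M. valid_types M \<and> size M = n}" (is "?T = ?V")
proof -
  let ?B = "carrier (hyperoctahedral n)"
  have sub: "?T \<subseteq> ?V" using valid_types_types size_types by auto
  have fin: "finite ?V" by (rule finite_valid_types)
  have pos: "card ?B > 0"
    using finite_hyperoctahedral group.is_monoid[OF group_hyperoctahedral]
    by (auto simp: card_gt_0_iff dest: monoid.one_closed)
  \<comment> \<open>The class equation: after division by the group order, the weights of the
    occurring multisets add up to 1.\<close>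
  have "real (card ?B) = (\<Sum>M\<in>?T. real (card (types_class n M)))"
  proof -
    have "card ?B = card {g \<in> ?B. types n g \<in> ?T}"
      by (rule arg_cong[of _ _ card]) auto
    also have "\<dots> = (\<Sum>M\<in>?T. card (types_class n M))"
      unfolding types_class_def
      by (rule card_eq_sum_card_fibers) (simp_all add: finite_hyperoctahedral)
    finally show ?thesis by simp
  qed
  also have "\<dots> = (\<Sum>M\<in>?T. real (card ?B) * (1 / real (centralizer_size M)))"
  proof (rule sum.cong[OF refl])
    fix M assume M: "M \<in> ?T"
    then have "types_class n M \<noteq> {}" by (auto simp: types_class_def)
    moreover have "centralizer_size M > 0"
      using M sub by (auto intro: centralizer_size_pos)
    ultimately show "real (card (types_class n M)) = real (card ?B) * (1 / real (centralizer_size M))"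
      using card_types_class by simp
  qed
  finally have T: "(\<Sum>M\<in>?T. 1 / real (centralizer_size M)) = 1"
    unfolding sum_distrib_left[symmetric] using pos by simp
  have "?V - ?T = {}"
  proof (rule ccontr)
    assume ne: "?V - ?T \<noteq> {}"
    have "0 < (\<Sum>M\<in>?V - ?T. 1 / real (centralizer_size M))"
    proof (rule sum_pos)
      fix M assume "M \<in> ?V - ?T"
      then have "0 < centralizer_size M" by (intro centralizer_size_pos) blast
      then show "0 < 1 / real (centralizer_size M)" by simp
    qed (use fin ne in simp_all)
    moreover have "(\<Sum>M\<in>?V. 1 / real (centralizer_size M)) =
        (\<Sum>M\<in>?V - ?T. 1 / real (centralizer_size M)) + (\<Sum>M\<in>?T. 1 / real (centralizer_size M))"
      by (rule sum.subset_diff[OF sub fin])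
    ultimately show False using T sum_valid_types[of n] by simp
  qed
  with sub show ?thesis by blast
qed

text \<open>Count the \<open>h\<close> whose k-th power lies in the class of \<open>g\<close>. By
  values of the power, this is the class size times the number of roots; by the types of
  \<open>h\<close>, it is the sum of the class sizes over the fiber. Class sizes are the group order
  divided by \<open>centralizer_size\<close>.\<close>

lemma roots_over_centralizer:
  assumes "k > 0" "g \<in> carrier (hyperoctahedral n)"
  shows "of_nat (roots k (hyperoctahedral n) g) / of_nat (centralizer_size (types n g)) =
    (fiber_weight (pow_type k) (types n g) :: 'a :: field_char_0)"
proof -
  let ?B = "carrier (hyperoctahedral n)" and ?N = "types n g"
  have pos: "card ?B > 0"
    using assms(2) finite_hyperoctahedral by (auto simp: card_gt_0_iff)
  \<comment> \<open>The formula for class sizes holds for classes that occur, so surjectivity of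
    \<open>types\<close> enters here.\<close>
  have fiber_nonempty: "types_class n M \<noteq> {}" if "M \<in> fiber (pow_type k) ?N" for M
  proof -
    have "M \<in> {M. valid_types M \<and> size M = n}"
      using that size_types[of n g] by (auto simp: fiber_def dest: arg_cong[of "image_mset _ _" _ size])
    then show ?thesis unfolding types_surj[symmetric] types_class_def by auto
  qed
  have "card (types_class n ?N) * roots k (hyperoctahedral n) g =
      (\<Sum>g'\<in>types_class n ?N. card {h \<in> ?B. h ^^ k = g'})"
  proof -
    have "card {h \<in> ?B. h ^^ k = g'} = roots k (hyperoctahedral n) g" if "g' \<in> types_class n ?N" for g'
      using that roots_hyperoctahedral_cong[OF _ assms(2), of g' k]
      by (simp add: types_class_def roots_def pow_hyperoctahedral)
    then show ?thesis by simp
  qed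
  also have "\<dots> = card {h \<in> ?B. h ^^ k \<in> types_class n ?N}"
    by (rule card_eq_sum_card_fibers[symmetric, OF finite_hyperoctahedral finite_types_class])
  also have "\<dots> = card {h \<in> ?B. types n h \<in> fiber (pow_type k) ?N}"
    using funpow_in_hyperoctahedral types_funpow[OF _ assms(1)] valid_types_types
    by (intro arg_cong[of _ _ card] Collect_cong) (auto simp: types_class_def fiber_def)
  also have "\<dots> = (\<Sum>M\<in>fiber (pow_type k) ?N. card (types_class n M))"
    unfolding types_class_def
    by (rule card_eq_sum_card_fibers[OF finite_hyperoctahedral finite_fiber])
  finally have "of_nat (card (types_class n ?N)) * of_nat (roots k (hyperoctahedral n) g) =
      (\<Sum>M\<in>fiber (pow_type k) ?N. of_nat (card (types_class n M)) :: 'a)"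
    by (metis of_nat_mult of_nat_sum)
  also have "\<dots> = of_nat (card ?B) * fiber_weight (pow_type k) ?N"
    unfolding fiber_weight_def sum_distrib_left
  proof (rule sum.cong[OF refl])
    fix M assume M: "M \<in> fiber (pow_type k) ?N"
    then have "centralizer_size M > 0" by (auto simp: fiber_def intro: centralizer_size_pos)
    then show "of_nat (card (types_class n M)) = of_nat (card ?B) * (1 / of_nat (centralizer_size M) :: 'a)"
      using card_types_class[OF fiber_nonempty[OF M]] by simp
  qed
  finally have eq: "of_nat (card (types_class n ?N)) * of_nat (roots k (hyperoctahedral n) g) =
      of_nat (card ?B) * (fiber_weight (pow_type k) ?N :: 'a)" .
  have "types_class n ?N \<noteq> {}" using assms(2) by (auto simp: types_class_def)
  note B = card_types_class[OF this]
  then have "card (types_class n ?N) > 0" "centralizer_size ?N > 0" using pos by auto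
  then show ?thesis using eq unfolding B by (simp add: field_simps)
qed

section \<open>The coefficients of the exponent\<close>

lemma pow_Z2: "\<epsilon> [^]\<^bsub>Z2\<^esub> (h :: nat) = \<epsilon> ^ h"
  by (induction h) (simp_all add: Z2_def nat_pow_def)

lemma roots_Z2: "roots h Z2 \<theta> = card {\<epsilon> \<in> {1, -1}. \<epsilon> ^ h = \<theta>}"
  by (simp add: roots_def pow_Z2 carrier_Z2)

text \<open>Write k = h d and l = j d; coprimality of h and j says that d = gcd l k. So l allows at
  most one divisor h, and it allows one exactly when a cycle of length l has a k-th power with
  cycles of length j.\<close>

lemma coprime_divisors_eq:
  assumes "k > 0" "j > (0 :: nat)"
  shows "{h. h dvd k \<and> coprime h j \<and> j * (k div h) = l} =
    (if j = l div gcd l k \<and> l > 0 then {k div gcd l k} else {})"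
proof (intro equalityI subsetI)
  fix h assume "h \<in> {h. h dvd k \<and> coprime h j \<and> j * (k div h) = l}"
  then obtain d where d: "k = h * d" "coprime h j" "l = j * d" "d > 0"
    using assms by (auto elim!: dvdE)
  have "gcd l k = d * gcd j h"
    unfolding d(1,3) by (simp only: gcd_mult_distrib_nat mult.commute)
  then have "gcd l k = d"
    using d(2) by (simp add: coprime_iff_gcd_eq_1 gcd.commute)
  then show "h \<in> (if j = l div gcd l k \<and> l > 0 then {k div gcd l k} else {})"
    using d assms by simp
next
  fix h assume "h \<in> (if j = l div gcd l k \<and> l > 0 then {k div gcd l k} else {})"
  then have h: "j = l div gcd l k" "l > 0" "h = k div gcd l k" by (auto split: if_splits)
  have "coprime h j"
    unfolding h using div_gcd_coprime[of l k] assms by (simp add: coprime_commute)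
  moreover have k: "k = h * gcd l k" unfolding h(3) by simp
  then have "h dvd k" by (rule dvdI)
  moreover have "k div h = gcd l k"
  proof -
    have "h > 0" using k assms by (intro gr0I) simp
    have "k div h = h * gcd l k div h" using k by (rule arg_cong)
    also have "\<dots> = gcd l k" using \<open>h > 0\<close> by simp
    finally show ?thesis .
  qed
  ultimately show "h \<in> {h. h dvd k \<and> coprime h j \<and> j * (k div h) = l}"
    using h(1) by simp
qed

text \<open>Both sides vanish unless A consists of l > 0 copies of one type (j, \<theta>). In that
  case at most the divisor h = k / gcd l k contributes, with denominator 2 l, whose l cancels
  against the degree. The roots of \<theta> that it counts are the signs \<epsilon> for which a
  cycle of type (l, \<epsilon>) has k-th power of type (j, \<theta>).\<close>

lemma nth_exponent_sum:
  assumes "k > 0"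
  shows "of_nat (size A) * mfps_nth (mfps_sum (exponent_term k) {1..}) A =
    of_nat (card (cycle_types_over (pow_type k) A)) / 2"
proof (cases "\<exists>l j \<theta>. l > 0 \<and> j > 0 \<and> \<theta> \<in> {1, -1} \<and> A = replicate_mset l (j, \<theta>)")
  case True
  then obtain l j \<theta> where l: "l > 0" "j > 0" "\<theta> \<in> {1, -1}" and A: "A = replicate_mset l (j, \<theta>)"
    by blast
  \<comment> \<open>As l is positive, the repeated element can be read off from the
    multiset.\<close>
  have rep: "A = replicate_mset e (i, \<eta>) \<longleftrightarrow> e = l \<and> i = j \<and> \<eta> = \<theta>" for e i \<eta>
  proof
    assume *: "A = replicate_mset e (i, \<eta>)"
    have "e = l" using arg_cong[OF *, of size] by (simp add: A)
    moreover have "(i, \<eta>) = (j, \<theta>)" using arg_cong[OF *, of set_mset] l(1) \<open>e = l\<close> by (simp add: A)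
    ultimately show "e = l \<and> i = j \<and> \<eta> = \<theta>" by simp
  qed (simp add: A)
  have nth_term: "mfps_nth (exponent_term k i) A =
      (if i = j \<and> i = l div gcd l k then of_nat (roots (k div gcd l k) Z2 \<theta>) / of_nat (2 * l) else 0)"
    if "i > 0" for i
  proof -
    have "mfps_nth (exponent_term k i) A = (\<Sum>\<eta>\<in>carrier Z2. \<Sum>h | h dvd k \<and> coprime h i.
        if i * (k div h) = l \<and> i = j \<and> \<eta> = \<theta> then of_nat (roots h Z2 \<theta>) / of_nat (2 * l) else 0)"
      unfolding mfps_nth_sum mfps_nth_const_mult mfps_var_power mfps_nth_Abs rep
      by (intro sum.cong refl) auto
    also have "\<dots> = (\<Sum>h | h dvd k \<and> coprime h i.
        if i * (k div h) = l \<and> i = j then of_nat (roots h Z2 \<theta>) / of_nat (2 * l) else 0)"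
      using l(3) by (auto simp: carrier_Z2)
    also have "\<dots> = (if i = j then \<Sum>h | h dvd k \<and> coprime h i \<and> i * (k div h) = l.
        of_nat (roots h Z2 \<theta>) / of_nat (2 * l) else 0)"
      using assms by (simp add: sum.inter_filter[symmetric] conj_assoc)
    finally show ?thesis
      unfolding coprime_divisors_eq[OF assms that] using l(1) by simp
  qed
  have "mfps_nth (mfps_sum (exponent_term k) {1..}) A =
      (if j = l div gcd l k then of_nat (roots (k div gcd l k) Z2 \<theta>) / of_nat (2 * l) else 0)"
  proof -
    have "mfps_nth (mfps_sum (exponent_term k) {1..}) A =
        (\<Sum>i | i \<in> {1..} \<and> mfps_nth (exponent_term k i) A \<noteq> 0. mfps_nth (exponent_term k i) A)"
      by (simp only: mfps_sum_def mfps_nth_Abs)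
    also have "\<dots> = (\<Sum>i\<in>{j}. mfps_nth (exponent_term k i) A)"
    proof (rule sum.mono_neutral_left)
      show "{i \<in> {1..}. mfps_nth (exponent_term k i) A \<noteq> 0} \<subseteq> {j}"
        using nth_term by (auto split: if_splits)
    qed (use l(2) in auto)
    finally show ?thesis using nth_term[OF l(2)] by simp
  qed
  moreover have "card (cycle_types_over (pow_type k) A) =
      (if j = l div gcd l k then roots (k div gcd l k) Z2 \<theta> else 0)"
  proof -
    have "cycle_types_over (pow_type k) A = {v. 0 < fst v \<and> snd v \<in> {1, -1} \<and>
        fst v = l \<and> fst v div gcd (fst v) k = j \<and> snd v ^ (k div gcd (fst v) k) = \<theta>}"
      unfolding cycle_types_over_def pow_type_def by (subst eq_commute[of _ A]) (simp only: rep)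
    also have "\<dots> = (if j = l div gcd l k then {l} \<times> {\<epsilon> \<in> {1, -1}. \<epsilon> ^ (k div gcd l k) = \<theta>} else {})"
      using l(1) by auto
    finally show ?thesis by (simp add: roots_Z2 card_cartesian_product)
  qed
  ultimately show ?thesis using l(1) by (simp add: A)
next
  case False
  have "fst (pow_type k v) > 0 \<and> snd (pow_type k v) \<in> {1, -1}" if "0 < fst v" "snd v \<in> {1, -1}" for v
    using that sign_power by (simp add: pow_type_def div_greater_zero_iff dvd_imp_le)
  with False have empty: "cycle_types_over (pow_type k) A = {}"
    unfolding cycle_types_over_def by (smt (verit) Collect_empty_eq prod.collapse)
  have zero: "mfps_nth (exponent_term k i) A = 0" if i: "i \<in> {1..}" for i
  proof -
    have "A \<noteq> replicate_mset (i * (k div h)) (i, \<eta>)" if "\<eta> \<in> carrier Z2" "h dvd k" for h \<eta>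
    proof -
      have "i * (k div h) > 0" using i that(2) assms by (auto elim!: dvdE)
      moreover have "\<eta> \<in> {1, -1}" "i > 0" using that(1) i by (auto simp: carrier_Z2)
      ultimately show ?thesis using False by metis
    qed
    then have "(if A = replicate_mset (i * (k div h)) (i, \<eta>) then 1 else 0 :: complex) = 0"
      if "\<eta> \<in> carrier Z2" "h \<in> {h. h dvd k \<and> coprime h i}" for h \<eta>
      using that by simp
    then show ?thesis
      unfolding mfps_nth_sum mfps_nth_const_mult mfps_var_power mfps_nth_Abs
      by (intro sum.neutral ballI) (simp only: mult_zero_right)
  qed
  have "mfps_nth (mfps_sum (exponent_term k) {1..}) A = 0"
    unfolding mfps_sum_def mfps_nth_Abs by (rule sum.neutral) (use zero in blast)
  then show ?thesis by (simp add: empty)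
qed

lemma nth_cycle_monomial: "mfps_nth (cycle_monomial \<mu>) N = (if N = types_of \<mu> then 1 else 0)"
  by (simp add: cycle_monomial_def types_of_def mfps_var_power mfps_prod_monom)

text \<open>Only n = size N and the bipartition with \<open>types_of\<close> equal to N can
  contribute, and for valid N the latter is the cycle type of a group element.\<close>

lemma nth_roots_series:
  assumes "k > 0"
  shows "mfps_nth (mfps_sum (\<lambda>n. \<Sum>\<mu>\<in>bipartitions n.
      mfps_const (of_nat (roots_B k n \<mu>) / of_nat (centralizer_order_B n \<mu>)) * cycle_monomial \<mu>) UNIV) N
    = fiber_weight (pow_type k) N"
proof -
  let ?c = "\<lambda>n \<mu>. of_nat (roots_B k n \<mu>) / of_nat (centralizer_order_B n \<mu>) :: complex"
  let ?t = "\<lambda>n. \<Sum>\<mu>\<in>bipartitions n. mfps_const (?c n \<mu>) * cycle_monomial \<mu>"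
  have nth_t: "mfps_nth (?t n) N = (\<Sum>\<mu>\<in>bipartitions n. if N = types_of \<mu> then ?c n \<mu> else 0)" for n
    unfolding mfps_nth_sum mfps_nth_const_mult nth_cycle_monomial by (intro sum.cong) auto
  define n where "n = size N"
  have "mfps_nth (mfps_sum ?t UNIV) N = (\<Sum>m | m \<in> UNIV \<and> mfps_nth (?t m) N \<noteq> 0. mfps_nth (?t m) N)"
    by (simp only: mfps_sum_def mfps_nth_Abs)
  also have "\<dots> = (\<Sum>m\<in>{n}. mfps_nth (?t m) N)"
  proof (rule sum.mono_neutral_left)
    show "{m \<in> UNIV. mfps_nth (?t m) N \<noteq> 0} \<subseteq> {n}"
    proof
      fix m assume "m \<in> {m \<in> UNIV. mfps_nth (?t m) N \<noteq> 0}"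
      then obtain \<mu> where "\<mu> \<in> bipartitions m" "N = types_of \<mu>"
        unfolding nth_t by (auto elim!: sum.not_neutral_contains_not_neutral split: if_splits)
      then show "m \<in> {n}" by (simp add: n_def size_types_of)
    qed
  qed auto
  also have "\<dots> = (\<Sum>\<mu>\<in>bipartitions n. if N = types_of \<mu> then ?c n \<mu> else 0)"
    by (simp only: nth_t sum.insert finite.emptyI empty_iff not_False_eq_True sum.empty add_0_right)
  also have "\<dots> = fiber_weight (pow_type k) N"
  proof (cases "valid_types N")
    case True
    then have "N \<in> types n ` carrier (hyperoctahedral n)"
      unfolding types_surj by (simp add: n_def)
    then obtain g where g: "g \<in> carrier (hyperoctahedral n)" "types n g = N" by auto
    let ?\<mu> = "cycle_type n g"
    have \<mu>: "?\<mu> \<in> bipartitions n" "types_of ?\<mu> = N"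
      using cycle_type_in_bipartitions[OF g(1)] types_of_cycle_type[OF g(1)] g(2) by auto
    have "N = types_of \<nu> \<longleftrightarrow> \<nu> = ?\<mu>" if "\<nu> \<in> bipartitions n" for \<nu>
      using inj_on_eq_iff[OF inj_types_of that \<mu>(1)] \<mu>(2) by metis
    then have "(\<Sum>\<nu>\<in>bipartitions n. if N = types_of \<nu> then ?c n \<nu> else 0) =
        (\<Sum>\<nu>\<in>bipartitions n. if \<nu> = ?\<mu> then ?c n \<nu> else 0)"
      by (intro sum.cong) auto
    also have "\<dots> = ?c n ?\<mu>"
      using \<mu>(1) by (simp add: sum.delta finite_bipartitions)
    also have "\<dots> = of_nat (roots k (hyperoctahedral n) g) / of_nat (centralizer_size (types n g))"
    proof -
      have "roots_B k n ?\<mu> = roots k (hyperoctahedral n) g"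
        unfolding roots_B_def by (intro class_value_eq g roots_hyperoctahedral_cong)
      moreover have "centralizer_order_B n ?\<mu> = card (centralizer (hyperoctahedral n) g)"
        unfolding centralizer_order_B_def by (intro class_value_eq g) (simp add: card_centralizer g)
      ultimately show ?thesis by (simp add: card_centralizer g(1))
    qed
    also have "\<dots> = fiber_weight (pow_type k) N"
      using roots_over_centralizer[OF assms g(1)] g(2) by simp
    finally show ?thesis .
  next
    case False
    \<comment> \<open>A member of the fiber would be realised by some \<open>h\<close>, and N, being
      the types of \<open>h ^^ k\<close>, would be valid.\<close>
    have "fiber (pow_type k) N = {}"
    proof (rule equals0I)
      fix M assume "M \<in> fiber (pow_type k) N"
      then have M: "valid_types M" "image_mset (pow_type k) M = N" by (auto simp: fiber_def)
      then have "M \<in> types n ` carrier (hyperoctahedral n)"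
        unfolding types_surj n_def by auto
      then obtain h where h: "h \<in> carrier (hyperoctahedral n)" "types n h = M" by auto
      then have "types n (h ^^ k) = N" using types_funpow[OF h(1) assms] M(2) by simp
      then show False
        using valid_types_types[OF funpow_in_hyperoctahedral[OF h(1)], of k] False by simp
    qed
    moreover have "N \<noteq> types_of \<mu>" if "\<mu> \<in> bipartitions n" for \<mu>
      using valid_types_of[OF that] False by auto
    ultimately show ?thesis by (simp add: fiber_weight_def)
  qed
  finally show ?thesis .
qed

theorem theorem3p1:
  fixes k :: nat
  assumes "k > 0"
  shows
    "mfps_sum (\<lambda>n. \<Sum>\<mu>\<in>bipartitions n.
        mfps_const (of_nat (roots_B k n \<mu>) / of_nat (centralizer_order_B n \<mu>)) * cycle_monomial \<mu>) UNIV
     = mfps_exp (mfps_sum (\<lambda>j. \<Sum>\<theta>\<in>carrier Z2. \<Sum>h | h dvd k \<and> coprime h j.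
         mfps_const (of_nat (roots h Z2 \<theta>) / of_nat (2 * j * (k div h)))
           * tvar j \<theta> ^ (j * (k div h))) {1..})"
proof (rule mfps_exp_eqI)
  show "mfps_nth (mfps_sum (exponent_term k) {1..}) {#} = 0"
    by (rule exponent_nth_empty[OF assms])
\<comment> \<open>The remaining goals, constant term 1 and the degree recursion, turn into facts
  about \<open>fiber_weight\<close> once the coefficients of both series are inserted.\<close>
qed (unfold nth_roots_series[OF assms] nth_exponent_sum[OF assms], rule fiber_weight_empty, rule fiber_weight_rec)

end
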